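(* Let $n\ge 7$. The coherent configuration $\mathcal C_n$ is non-separable if and only if $n$ is a multiple of $7$.
   Context: A coherent configuration on a finite set $V$ is a partition $\mathcal C$ of $V\times V$ into basis relations such that: (A) a basis relation containing a loop consists of loops; (B) the transpose of a basis relation is a basis relation; (C) for all $R,S,T\in\mathcal C$ the number $|\{w:uw\in R,wv\in S\}|$ is the same for all $uv\in T$, denoted $p^T_{RS}$. For $n\ge 7$, the cyclic $(n_3)$-configuration $D_n$ has point set $\mathbb Z_n$ and lines $\{i,i+2,i+3\}$, $i\in\mathbb Z_n$. $\mathcal C_n$ is constructed from $D_n$ as follows: for each $i\in\mathbb Z_n$ take a 4-point set $X_i$ (pairwise disjoint); the basis relations inside $X_i\times X_i$ are the loop relation on $X_i$ and the three perfect matchings (symmetric irreflexive relations of valency 1) on $X_i$; to each line $L$ through $i$ assign one of these three matchings $M_{i,L}$, distinct lines getting distinct matchings; for $i\neq j$ on a common line $L$, $X_i\times X_j$ is split into two basis relations $R$ and $(X_i\times X_j)\setminus R$ (with their transposes in $X_j\times X_i$), where $R=\{a_1,a_2\}\times\{b_1,b_2\}\cup\{a_3,a_4\}\times\{b_3,b_4\}$ with $\{a_1a_2,a_2a_1,a_3a_4,a_4a_3\}=M_{i,L}$ and $\{b_1b_2,b_2b_1,b_3b_4,b_4b_3\}=M_{j,L}$; for $i\ne j$ not on a common line, $X_i\times X_j$ is a single basis relation. (The result does not depend on the choices made.) $\mathcal C$ is separable if every algebraic isomorphism (bijection $f:\mathcal C\to\mathcal C'$ onto a coherent configuration with $p^T_{RS}=p^{f(T)}_{f(R)f(S)}$)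 is induced by a combinatorial isomorphism (bijection $\phi$ of point sets with $\phi(R)=f(R)$ for all $R$). *)

theory Defs
  imports Main "HOL-Library.Disjoint_Sets"
begin

definition coherent_configuration :: "'a set \<Rightarrow> ('a \<times> 'a) set set \<Rightarrow> bool" where
  "coherent_configuration V C \<longleftrightarrow>
     finite V \<and> partition_on (V \<times> V) C \<and>
     (\<forall>R\<in>C. (\<exists>u. (u, u) \<in> R) \<longrightarrow> R \<subseteq> Id) \<and>
     (\<forall>R\<in>C. R\<inverse> \<in> C) \<and>
     (\<forall>R\<in>C. \<forall>S\<in>C. \<forall>T\<in>C. \<exists>p. \<forall>(u, v)\<in>T. card {w. (u, w) \<in> R \<and> (w, v) \<in> S} = p)"

(* The number p with superscript T and subscript RS; the description is well defined for basis
   relations of a coherent configuration, since these are nonempty. *)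
definition intersection_number ::
    "('a \<times> 'a) set \<Rightarrow> ('a \<times> 'a) set \<Rightarrow> ('a \<times> 'a) set \<Rightarrow> nat" where
  "intersection_number R S T =
     (THE p. \<forall>(u, v)\<in>T. card {w. (u, w) \<in> R \<and> (w, v) \<in> S} = p)"

definition algebraic_isomorphism ::
    "('a \<times> 'a) set set \<Rightarrow> ('b \<times> 'b) set set \<Rightarrow> (('a \<times> 'a) set \<Rightarrow> ('b \<times> 'b) set) \<Rightarrow> bool" where
  "algebraic_isomorphism C C' f \<longleftrightarrow>
     bij_betw f C C' \<and>
     (\<forall>R\<in>C. \<forall>S\<in>C. \<forall>T\<in>C.
        intersection_number R S T = intersection_number (f R) (f S) (f T))"

definition induced_by ::
    "'a set \<Rightarrow> ('a \<times> 'a) set set \<Rightarrow> 'b set \<Rightarrow> (('a \<times> 'a) set \<Rightarrow> ('b \<times> 'b) set) \<Rightarrow> ('a \<Rightarrow> 'b) \<Rightarrow> bool"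
  where
  "induced_by V C V' f \<phi> \<longleftrightarrow> bij_betw \<phi> V V' \<and> (\<forall>R\<in>C. map_prod \<phi> \<phi> ` R = f R)"

(* HOL cannot quantify over the type of the target points inside a definition.  Targets on finite
   sets of natural numbers represent all targets up to renaming of points; the lemma
   separable_any_target below confirms that the choice of type is immaterial. *)
definition separable :: "'a set \<Rightarrow> ('a \<times> 'a) set set \<Rightarrow> bool" where
  "separable V C \<longleftrightarrow>
     (\<forall>(V' :: nat set) C' f.
        coherent_configuration V' C' \<longrightarrow> algebraic_isomorphism C C' f \<longrightarrow>
        (\<exists>\<phi>. induced_by V C V' f \<phi>))"

(* Residues modulo n are represented by the natural numbers below n. *)
definition cyclic_lines :: "nat \<Rightarrow> nat set set" where
  "cyclic_lines n = (\<lambda>i. {i, (i + 2) mod n, (i + 3) mod n}) ` {..<n}"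

definition perfect_matching :: "'a set \<Rightarrow> ('a \<times> 'a) set \<Rightarrow> bool" where
  "perfect_matching A R \<longleftrightarrow>
     R \<subseteq> A \<times> A \<and> sym R \<and> irrefl R \<and> (\<forall>a\<in>A. \<exists>!b. (a, b) \<in> R)"

(* The choices entering the construction: the sets X i and the matchings M i L. *)
definition cyclic_choices ::
    "nat \<Rightarrow> (nat \<Rightarrow> 'a set) \<Rightarrow> (nat \<Rightarrow> nat set \<Rightarrow> ('a \<times> 'a) set) \<Rightarrow> bool" where
  "cyclic_choices n X M \<longleftrightarrow>
     (\<forall>i<n. card (X i) = 4) \<and>
     disjoint_family_on X {..<n} \<and>
     (\<forall>i<n. \<forall>L\<in>cyclic_lines n. i \<in> L \<longrightarrow> perfect_matching (X i) (M i L)) \<and>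
     (\<forall>i<n. inj_on (M i) {L \<in> cyclic_lines n. i \<in> L})"

(* The labellings of M and N determine P only up to complement in A \<times> B, so for perfect
   matchings M of A and N of B with card A = card B = 4 this set has exactly two elements. *)
definition split_relations ::
    "'a set \<Rightarrow> 'a set \<Rightarrow> ('a \<times> 'a) set \<Rightarrow> ('a \<times> 'a) set \<Rightarrow> ('a \<times> 'a) set set" where
  "split_relations A B M N =
     {R. \<exists>a1 a2 a3 a4 b1 b2 b3 b4 P.
           M = {(a1, a2), (a2, a1), (a3, a4), (a4, a3)} \<and>
           N = {(b1, b2), (b2, b1), (b3, b4), (b4, b3)} \<and>
           P = {a1, a2} \<times> {b1, b2} \<union> {a3, a4} \<times> {b3, b4} \<and>
           (R = P \<or> R = A \<times> B - P)}"

definition cyclic_points :: "nat \<Rightarrow> (nat \<Rightarrow> 'a set) \<Rightarrow> 'a set" where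
  "cyclic_points n X = (\<Union>i<n. X i)"

definition cyclic_configuration ::
    "nat \<Rightarrow> (nat \<Rightarrow> 'a set) \<Rightarrow> (nat \<Rightarrow> nat set \<Rightarrow> ('a \<times> 'a) set) \<Rightarrow> ('a \<times> 'a) set set" where
  "cyclic_configuration n X M =
     (\<Union>i<n. insert (Id_on (X i)) {R. perfect_matching (X i) R}) \<union>
     (\<Union>L\<in>cyclic_lines n. \<Union>i\<in>L. \<Union>j\<in>L - {i}. split_relations (X i) (X j) (M i L) (M j L)) \<union>
     {X i \<times> X j | i j. i < n \<and> j < n \<and> i \<noteq> j \<and> \<not> (\<exists>L\<in>cyclic_lines n. i \<in> L \<and> j \<in> L)}"

lemma cyclic_choices_exist: "\<exists>(X :: nat \<Rightarrow> (nat \<times> nat) set) M. cyclic_choices n X M"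
proof -
  define X :: "nat \<Rightarrow> (nat \<times> nat) set" where "X i = {(i, 0), (i, 1), (i, 2), (i, 3)}" for i
  define m1 :: "nat \<Rightarrow> ((nat \<times> nat) \<times> (nat \<times> nat)) set" where
    "m1 i = {((i, 0), (i, 1)), ((i, 1), (i, 0)), ((i, 2), (i, 3)), ((i, 3), (i, 2))}" for i
  define m2 :: "nat \<Rightarrow> ((nat \<times> nat) \<times> (nat \<times> nat)) set" where
    "m2 i = {((i, 0), (i, 2)), ((i, 2), (i, 0)), ((i, 1), (i, 3)), ((i, 3), (i, 1))}" for i
  define m3 :: "nat \<Rightarrow> ((nat \<times> nat) \<times> (nat \<times> nat)) set" where
    "m3 i = {((i, 0), (i, 3)), ((i, 3), (i, 0)), ((i, 1), (i, 2)), ((i, 2), (i, 1))}" for i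
  have pm: "perfect_matching (X i) (m1 i)" "perfect_matching (X i) (m2 i)"
      "perfect_matching (X i) (m3 i)" for i
    by (auto simp: perfect_matching_def X_def m1_def m2_def m3_def sym_def irrefl_def)
  have "m1 i \<noteq> m2 i" "m1 i \<noteq> m3 i" "m2 i \<noteq> m3 i" for i
  proof -
    have "((i, 0), (i, 1)) \<in> m1 i" "((i, 0), (i, 1)) \<notin> m2 i" "((i, 0), (i, 1)) \<notin> m3 i"
      "((i, 0), (i, 2)) \<in> m2 i" "((i, 0), (i, 2)) \<notin> m3 i"
      by (simp_all add: m1_def m2_def m3_def)
    then show "m1 i \<noteq> m2 i" "m1 i \<noteq> m3 i" "m2 i \<noteq> m3 i" by metis+
  qed
  then have card3: "card {m1 i, m2 i, m3 i} = 3" for i by simp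
  define line where "line = (\<lambda>i. {i, (i + 2) mod n, (i + 3) mod n})"
  have "\<exists>h. h ` {L \<in> cyclic_lines n. i \<in> L} \<subseteq> {m1 i, m2 i, m3 i} \<and>
      inj_on h {L \<in> cyclic_lines n. i \<in> L}" if i: "i < n" for i
  proof -
    have shift: "k = (i + (n - c mod n)) mod n" if "i = (k + c) mod n" "k < n" for k c
    proof -
      have "c mod n < n" using i by simp
      have "(i + (n - c mod n)) mod n = (k + c mod n + (n - c mod n)) mod n"
        unfolding that(1) by (metis mod_add_left_eq mod_add_right_eq)
      also have "k + c mod n + (n - c mod n) = k + n" using \<open>c mod n < n\<close> by simp
      finally show ?thesis using that(2) by simp
    qed
    have sub: "{L \<in> cyclic_lines n. i \<in> L}
        \<subseteq> {line i, line ((i + (n - 2 mod n)) mod n), line ((i + (n - 3 mod n)) mod n)}"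
    proof
      fix L assume "L \<in> {L \<in> cyclic_lines n. i \<in> L}"
      then obtain k where k: "k < n" "L = line k" "i = k \<or> i = (k + 2) mod n \<or> i = (k + 3) mod n"
        by (auto simp: cyclic_lines_def line_def)
      then have "k = i \<or> k = (i + (n - 2 mod n)) mod n \<or> k = (i + (n - 3 mod n)) mod n"
        using shift[OF _ k(1), of 2] shift[OF _ k(1), of 3] k(3) by blast
      then show "L \<in> {line i, line ((i + (n - 2 mod n)) mod n), line ((i + (n - 3 mod n)) mod n)}"
        unfolding k(2) by blast
    qed
    have "card {L \<in> cyclic_lines n. i \<in> L} \<le> 3"
      by (rule order_trans[OF card_mono[OF _ sub]]) (auto simp: card_insert_if)
    moreover have "finite {L \<in> cyclic_lines n. i \<in> L}" by (rule finite_subset[OF sub]) simp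
    ultimately show ?thesis using card_le_inj[of _ "{m1 i, m2 i, m3 i}"] card3[of i] by simp
  qed
  then have "\<forall>i. \<exists>h. i < n \<longrightarrow> h ` {L \<in> cyclic_lines n. i \<in> L} \<subseteq> {m1 i, m2 i, m3 i} \<and>
      inj_on h {L \<in> cyclic_lines n. i \<in> L}"
    by blast
  from choice[OF this] obtain M where M: "\<And>i. i < n \<Longrightarrow> M i ` {L \<in> cyclic_lines n. i \<in> L} \<subseteq> {m1 i, m2 i, m3 i} \<and>
      inj_on (M i) {L \<in> cyclic_lines n. i \<in> L}"
    by blast
  have "perfect_matching (X i) (M i L)" if "i < n" "L \<in> cyclic_lines n" "i \<in> L" for i L
  proof -
    have "M i L \<in> {m1 i, m2 i, m3 i}" using M[OF that(1)] that by blast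
    then show ?thesis using pm by auto
  qed
  moreover have "card (X i) = 4" for i by (simp add: X_def)
  moreover have "disjoint_family_on X {..<n}" by (auto simp: disjoint_family_on_def X_def)
  ultimately have "cyclic_choices n X M" using M by (simp add: cyclic_choices_def)
  then show ?thesis by blast
qed

lemma card_paths_image:
  assumes g: "inj_on g V" and R: "R \<subseteq> V \<times> V" and S: "S \<subseteq> V \<times> V" and uv: "u \<in> V" "v \<in> V"
  shows "card {w. (g u, w) \<in> map_prod g g ` R \<and> (w, g v) \<in> map_prod g g ` S}
       = card {w. (u, w) \<in> R \<and> (w, v) \<in> S}"
proof -
  have mem: "(g x, g y) \<in> map_prod g g ` Q \<longleftrightarrow> (x, y) \<in> Q"
    if "x \<in> V" "y \<in> V" "Q \<subseteq> V \<times> V" for x y Q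
    proof
    assume "(g x, g y) \<in> map_prod g g ` Q"
    then obtain x' y' where "(x', y') \<in> Q" "g x = g x'" "g y = g y'" by auto
    moreover from this have "x = x'" "y = y'" using that g by (auto dest: inj_onD)
    ultimately show "(x, y) \<in> Q" by simp
  qed auto
  have "{w. (g u, w) \<in> map_prod g g ` R \<and> (w, g v) \<in> map_prod g g ` S}
      = g ` {w. (u, w) \<in> R \<and> (w, v) \<in> S}" (is "?A = g ` ?B")
  proof
    show "?A \<subseteq> g ` ?B"
    proof
      fix w assume w: "w \<in> ?A"
      then obtain x where x: "x \<in> V" "w = g x" using R by fastforce
      then have "x \<in> ?B" using w mem uv R S by simp
      then show "w \<in> g ` ?B" using x by simp
    qed
    show "g ` ?B \<subseteq> ?A" by auto
  qed
  moreover have "inj_on g ?B" using g R by (auto intro: inj_on_subset)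
  ultimately show ?thesis by (simp add: card_image)
qed

lemma separable_any_target:
  fixes V :: "'a set" and V' :: "'b set"
  assumes sep: "separable V C"
    and coh: "coherent_configuration V' C'" and alg: "algebraic_isomorphism C C' f"
  shows "\<exists>\<phi>. induced_by V C V' f \<phi>"
proof -
  have "finite V'" using coh by (simp add: coherent_configuration_def)
  then obtain g :: "'b \<Rightarrow> nat" where g: "inj_on g V'"
    by (meson finite_imp_inj_to_nat_seg)
  let ?G = "\<lambda>R. map_prod g g ` R"
  have G: "inj_on (map_prod g g) (V' \<times> V')" using g by (simp add: map_prod_inj_on)
  have part: "partition_on (V' \<times> V') C'" using coh by (simp add: coherent_configuration_def)
  have sub: "R \<subseteq> V' \<times> V'" and ne: "R \<noteq> {}" if "R \<in> C'" for R
    using that part by (auto simp: partition_on_def)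
  have card_eq: "(\<forall>(u, v)\<in>?G T. card {w. (u, w) \<in> ?G R \<and> (w, v) \<in> ?G S} = p) \<longleftrightarrow>
      (\<forall>(u, v)\<in>T. card {w. (u, w) \<in> R \<and> (w, v) \<in> S} = p)"
    if "R \<in> C'" "S \<in> C'" "T \<in> C'" for R S T p
  proof -
    have "card {w. (g u, w) \<in> ?G R \<and> (w, g v) \<in> ?G S} = card {w. (u, w) \<in> R \<and> (w, v) \<in> S}"
      if "(u, v) \<in> T" for u v
      using card_paths_image[OF g sub[OF \<open>R \<in> C'\<close>] sub[OF \<open>S \<in> C'\<close>]] that sub[OF \<open>T \<in> C'\<close>] by blast
    then have "card {w. (fst (map_prod g g z), w) \<in> ?G R \<and> (w, snd (map_prod g g z)) \<in> ?G S}
        = card {w. (fst z, w) \<in> R \<and> (w, snd z) \<in> S}" if "z \<in> T" for z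
      using that by (cases z) simp
    then show ?thesis by (simp only: case_prod_unfold ball_simps(9) cong: ball_cong)
  qed
  have "partition_on (g ` V' \<times> g ` V') (?G ` C')"
  proof -
    have "\<Union> (?G ` C') = ?G (\<Union> C')" by blast
    moreover have "\<Union> C' = V' \<times> V'" using part by (simp add: partition_on_def)
    moreover have "?G (V' \<times> V') = g ` V' \<times> g ` V'" by auto
    moreover have "disjoint (?G ` C')"
    proof (rule disjointI)
      fix a b assume "a \<in> ?G ` C'" "b \<in> ?G ` C'" "a \<noteq> b"
      then obtain A B where AB: "A \<in> C'" "B \<in> C'" "a = ?G A" "b = ?G B" "A \<noteq> B" by blast
      then have "A \<inter> B = {}" using part by (auto simp: partition_on_def disjoint_def)
      then show "a \<inter> b = {}"
        using inj_on_image_Int[OF G sub[OF AB(1)] sub[OF AB(2)]] AB by simp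
    qed
    ultimately show ?thesis using ne[of "{}"] by (auto simp: partition_on_def)
  qed
  moreover have "\<forall>R\<in>?G ` C'. (\<exists>u. (u, u) \<in> R) \<longrightarrow> R \<subseteq> Id"
  proof (intro ballI impI)
    fix r assume "r \<in> ?G ` C'" "\<exists>u. (u, u) \<in> r"
    then obtain R x y where R: "R \<in> C'" "r = ?G R" "(x, y) \<in> R" "g x = g y" by auto
    then have "x = y" using sub[OF R(1)] g by (auto simp: inj_on_def)
    then have "R \<subseteq> Id" using R coh unfolding coherent_configuration_def by blast
    then show "r \<subseteq> Id" using R by auto
  qed
  moreover have "\<forall>R\<in>?G ` C'. R\<inverse> \<in> ?G ` C'"
  proof
    fix r assume "r \<in> ?G ` C'"
    then obtain R where R: "R \<in> C'" "r = ?G R" by auto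
    have "r\<inverse> = ?G (R\<inverse>)" using R by auto
    then show "r\<inverse> \<in> ?G ` C'" using R coh unfolding coherent_configuration_def by blast
  qed
  moreover have "\<forall>R\<in>?G ` C'. \<forall>S\<in>?G ` C'. \<forall>T\<in>?G ` C'.
      \<exists>p. \<forall>(u, v)\<in>T. card {w. (u, w) \<in> R \<and> (w, v) \<in> S} = p"
  proof (intro ballI)
    fix r s t assume "r \<in> ?G ` C'" "s \<in> ?G ` C'" "t \<in> ?G ` C'"
    then obtain R S T where RST: "R \<in> C'" "S \<in> C'" "T \<in> C'"
      and eq: "r = ?G R" "s = ?G S" "t = ?G T" by blast
    have "\<exists>p. \<forall>(u, v)\<in>T. card {w. (u, w) \<in> R \<and> (w, v) \<in> S} = p"
      using coh RST by (simp add: coherent_configuration_def)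
    then show "\<exists>p. \<forall>(u, v)\<in>t. card {w. (u, w) \<in> r \<and> (w, v) \<in> s} = p"
      unfolding eq card_eq[OF RST] .
  qed
  ultimately have coh': "coherent_configuration (g ` V') (?G ` C')"
    using \<open>finite V'\<close> unfolding coherent_configuration_def by blast
  have "inj_on ?G C'"
    using sub by (intro inj_onI) (metis inj_on_image_eq_iff[OF G])
  moreover have "intersection_number (?G R) (?G S) (?G T) = intersection_number R S T"
    if "R \<in> C'" "S \<in> C'" "T \<in> C'" for R S T
    using card_eq[OF that] unfolding intersection_number_def by simp
  ultimately have "algebraic_isomorphism C (?G ` C') (?G \<circ> f)"
    using alg unfolding algebraic_isomorphism_def
    by (auto intro!: bij_betw_trans[of f C C'] simp: inj_on_imp_bij_betw bij_betw_apply)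
  then obtain \<psi> where psi: "induced_by V C (g ` V') (?G \<circ> f) \<psi>"
    using sep coh' unfolding separable_def by blast
  define h where "h = inv_into V' g"
  have hg: "h (g x) = x" if "x \<in> V'" for x using that g by (simp add: h_def)
  have "bij_betw (h \<circ> \<psi>) V V'"
    using psi inj_on_imp_bij_betw[OF g] unfolding induced_by_def h_def
    by (auto intro: bij_betw_trans bij_betw_inv_into)
  moreover have "map_prod (h \<circ> \<psi>) (h \<circ> \<psi>) ` R = f R" if R: "R \<in> C" for R
  proof -
    have fR: "f R \<subseteq> V' \<times> V'"
      using R alg sub by (auto simp: algebraic_isomorphism_def dest: bij_betw_apply)
    have "map_prod (h \<circ> \<psi>) (h \<circ> \<psi>) ` R = map_prod h h ` (map_prod \<psi> \<psi> ` R)"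
      by (simp add: image_comp map_prod.comp)
    also have "\<dots> = map_prod h h ` ?G (f R)" using psi R by (simp add: induced_by_def)
    also have "\<dots> = (\<lambda>z. z) ` f R"
      unfolding image_image using fR hg by (intro image_cong) auto
    finally show ?thesis by simp
  qed
  ultimately have "induced_by V C V' f (h \<circ> \<psi>)" by (simp add: induced_by_def)
  then show ?thesis by blast
qed

end

(* Label the points of X_i by their coordinates h_l in F_2, one for each line l
   through i, where h_l is constant on the edges of the matching assigned to l and the three
   coordinates of a point add up to 0. The colour of a pair (x, y) is then the vector of the sums
   h_l(x) + h_l(y) over the lines l through both fibres. An algebraic isomorphism can only add bits to
   these sums, and coherence on a line forces the bits to have the form d(i, l) + d(j, l); conversely
   every d occurs, since only three fibres enter an intersection number and d can be undone there by
   a translation of the middle fibre. The isomorphism is induced iff d can be corrected by a function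
   e of the lines alone so that its sum over the lines through each point vanishes. Hence the
   configuration is separable iff the incidence matrix is invertible over F_2. This matrix is the
   circulant of 1 + x^2 + x^3, whose roots have order 7, so it is singular iff 7 divides n. *)
theory Submission
  imports Defs "HOL-Library.Z2" "HOL-Library.FuncSet" "HOL-Computational_Algebra.Primes"
begin

text \<open>The coordinates in a fibre obey one parity condition. Three lines pass through a point
  and two points share at most one line, so some line through a point misses any two other given
  points and can absorb that parity. Hence a translation of a fibre can be prescribed freely on its
  lines towards two other fibres, which is all that a triple of points can see. Over all fibres at
  once the parities no longer decouple, and this is how the incidence matrix appears.

  A change of d(i, .) whose sum over the lines through i is 0 amounts to a translation of one fibre.
  The obstruction is therefore the vector D of the sums of d(i, l) over l, up to the image of the
  incidence matrix; this is why separability is expressed as solvability for every right side D.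

  In the direction from solvability to separability the target carries no coordinates. They are
  rebuilt from triples of its points: on each line the colour bits form a cocycle, base points in
  the fibres turn it into a coboundary, and only the parity in each fibre remains to be
  repaired.\<close>

declare add_bit_eq_xor [simp del] mult_bit_eq_and [simp del]

lemma bit_add_self: "a + a = (0::bit)"
  by (cases a) auto

lemma bit_add_left_self: "a + (a + b) = (b::bit)"
  by (simp add: bit_add_self flip: add.assoc)

lemma bit_add_eq_iff: "a + b = c \<longleftrightarrow> a = b + (c::bit)"
  by (cases a; cases b; cases c) (simp_all add: bit_add_self)

lemmas bit_simps = add_ac bit_add_self bit_add_left_self

section \<open>Colourings by sums of coordinates\<close>

lemma intersection_number_eq:
  assumes "coherent_configuration V C" "R \<in> C" "S \<in> C" "T \<in> C" "(u, v) \<in> T"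
  shows "intersection_number R S T = card {w. (u, w) \<in> R \<and> (w, v) \<in> S}"
proof -
  obtain p where p: "\<forall>(u, v)\<in>T. card {w. (u, w) \<in> R \<and> (w, v) \<in> S} = p"
    using assms unfolding coherent_configuration_def by blast
  then have "intersection_number R S T = p"
    unfolding intersection_number_def using assms(5) by (intro the_equality) auto
  then show ?thesis using p assms(5) by auto
qed

text \<open>Equal cardinalities of finite sets vanish together. This existence of paths is all that
  the direction from solvability to separability takes from the intersection numbers.\<close>

lemma algebraic_isomorphism_paths:
  assumes C: "coherent_configuration V C" and C': "coherent_configuration V' C'"
    and f: "algebraic_isomorphism C C' f"
    and RST: "R \<in> C" "S \<in> C" "T \<in> C" and T: "(u, v) \<in> T" "(x, y) \<in> f T"
  shows "(\<exists>w. (u, w) \<in> R \<and> (w, v) \<in> S) \<longleftrightarrow> (\<exists>w. (x, w) \<in> f R \<and> (w, y) \<in> f S)"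
proof -
  have fC: "f Q \<in> C'" if "Q \<in> C" for Q
    using f that by (auto simp: algebraic_isomorphism_def dest: bij_betw_apply)
  have sub: "\<Union> C = V \<times> V" "\<Union> C' = V' \<times> V'" and fin: "finite V" "finite V'"
    using C C' by (simp_all add: coherent_configuration_def partition_on_def)
  have eq: "card {w. (u, w) \<in> R \<and> (w, v) \<in> S} = card {w. (x, w) \<in> f R \<and> (w, y) \<in> f S}"
    using intersection_number_eq[OF C RST T(1)] f RST
      intersection_number_eq[OF C' fC[OF RST(1)] fC[OF RST(2)] fC[OF RST(3)] T(2)]
    by (simp add: algebraic_isomorphism_def)
  have fin1: "finite {w. (u, w) \<in> R \<and> (w, v) \<in> S}"
    using RST sub by (intro finite_subset[OF _ fin(1)]) blast
  have fin2: "finite {w. (x, w) \<in> f R \<and> (w, y) \<in> f S}"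
    using fC[OF RST(1)] sub by (intro finite_subset[OF _ fin(2)]) blast
  have "{w. (u, w) \<in> R \<and> (w, v) \<in> S} = {} \<longleftrightarrow> {w. (x, w) \<in> f R \<and> (w, y) \<in> f S} = {}"
    unfolding card_0_eq[OF fin1, symmetric] card_0_eq[OF fin2, symmetric] eq ..
  then show ?thesis by blast
qed

text \<open>\<open>P\<close> and \<open>thru\<close> are the points and incidences of the geometry,
  \<open>ty\<close> names the fibre of a configuration point and \<open>h l\<close> is its
  coordinate for the line \<open>l\<close>. By \<open>h_sum\<close>, \<open>point_ex\<close> and
  \<open>point_eq\<close> each fibre is a copy of the vectors of sum 0 in F_2^3, a Klein
  four-group.\<close>

locale affine_configuration =
  fixes P :: "'p set" and thru :: "'p \<Rightarrow> 'l \<Rightarrow> bool"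
    and V :: "'a set" and ty :: "'a \<Rightarrow> 'p" and h :: "'l \<Rightarrow> 'a \<Rightarrow> bit"
  assumes finite_V: "finite V"
    and ty_P: "x \<in> V \<Longrightarrow> ty x \<in> P"
    and three: "i \<in> P \<Longrightarrow> card {l. thru i l} = 3"
    and linear: "thru i l \<Longrightarrow> thru j l \<Longrightarrow> thru i m \<Longrightarrow> thru j m \<Longrightarrow> i \<noteq> j \<Longrightarrow> l = m"
    and h_sum: "x \<in> V \<Longrightarrow> (\<Sum>l | thru (ty x) l. h l x) = 0"
    and point_ex: "i \<in> P \<Longrightarrow> (\<Sum>l | thru i l. t l) = 0 \<Longrightarrow>
      \<exists>x\<in>V. ty x = i \<and> (\<forall>l. thru i l \<longrightarrow> h l x = t l)"
    and point_eq: "x \<in> V \<Longrightarrow> y \<in> V \<Longrightarrow> ty x = ty y \<Longrightarrow>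
      (\<And>l. thru (ty x) l \<Longrightarrow> h l x = h l y) \<Longrightarrow> x = y"
begin

text \<open>Lines not through both fibres receive 0, so that colours can be compared by plain
  equality. Within a fibre all three lines count, between distinct collinear fibres exactly one,
  otherwise none: these are the three kinds of basis relations.\<close>

definition color :: "'a \<Rightarrow> 'a \<Rightarrow> 'p \<times> 'p \<times> ('l \<Rightarrow> bit)" where
  "color x y = (ty x, ty y, \<lambda>l. if thru (ty x) l \<and> thru (ty y) l then h l x + h l y else 0)"

definition color_class :: "'p \<times> 'p \<times> ('l \<Rightarrow> bit) \<Rightarrow> ('a \<times> 'a) set" where
  "color_class t = {(x, y). x \<in> V \<and> y \<in> V \<and> color x y = t}"

definition classes :: "('a \<times> 'a) set set" where
  "classes = {color_class (color x y) | x y. x \<in> V \<and> y \<in> V}"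

text \<open>For i = j the two added bits cancel, so loops and matchings keep their colours; only the
  pairs between distinct collinear fibres are affected.\<close>

definition flip :: "('p \<Rightarrow> 'l \<Rightarrow> bit) \<Rightarrow> 'p \<times> 'p \<times> ('l \<Rightarrow> bit) \<Rightarrow> 'p \<times> 'p \<times> ('l \<Rightarrow> bit)" where
  "flip d = (\<lambda>(i, j, c). (i, j, \<lambda>l. if thru i l \<and> thru j l then c l + d i l + d j l else 0))"

lemma color_eq_iff:
  "color x y = (i, j, c) \<longleftrightarrow> ty x = i \<and> ty y = j \<and>
    (\<forall>l. (thru i l \<and> thru j l \<longrightarrow> h l x + h l y = c l) \<and> (\<not> (thru i l \<and> thru j l) \<longrightarrow> c l = 0))"
  unfolding color_def by (auto simp: fun_eq_iff)

lemma color_eq_color_iff: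
  "color x y = color x' y' \<longleftrightarrow> ty x = ty x' \<and> ty y = ty y' \<and>
    (\<forall>l. thru (ty x) l \<longrightarrow> thru (ty y) l \<longrightarrow> h l x + h l y = h l x' + h l y')"
  unfolding color_def by (auto simp: fun_eq_iff)

lemma color_eq_flip_iff:
  "color x y = flip d (color x' y') \<longleftrightarrow> ty x = ty x' \<and> ty y = ty y' \<and>
    (\<forall>l. thru (ty x) l \<longrightarrow> thru (ty y) l \<longrightarrow>
      h l x + h l y = h l x' + h l y' + d (ty x) l + d (ty y) l)"
  unfolding color_def flip_def by (auto simp: fun_eq_iff)

lemma flip_flip: "flip d (flip d (color x y)) = color x y"
  unfolding color_def flip_def by (auto simp: fun_eq_iff bit_simps)

lemma flip_zero: "flip (\<lambda>_ _. 0) (color x y) = color x y"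
  unfolding color_def flip_def by (auto simp: fun_eq_iff)

section \<open>Translations of a fibre with prescribed values\<close>

lemma finite_thru: "i \<in> P \<Longrightarrow> finite {l. thru i l}"
  using three by (metis card.infinite zero_neq_numeral)

text \<open>The entry at \<open>m\<close> is set to the sum of the others, so that the total is
  twice this sum, hence 0.\<close>

lemma sum_zero_extend:
  assumes "i \<in> P" "thru i m"
  obtains t where "(\<Sum>l | thru i l. t l) = (0::bit)" "\<And>l. l \<noteq> m \<Longrightarrow> t l = s l"
proof -
  define t where "t = s(m := \<Sum>l\<in>{l. thru i l} - {m}. s l)"
  have "(\<Sum>l | thru i l. t l) = t m + (\<Sum>l\<in>{l. thru i l} - {m}. t l)"
    using assms finite_thru by (intro sum.remove) auto
  also have "(\<Sum>l\<in>{l. thru i l} - {m}. t l) = t m"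
    unfolding t_def by (auto intro: sum.cong)
  finally show ?thesis by (intro that[of t]) (auto simp: bit_add_self t_def)
qed

text \<open>Each of i and k shares at most one of the three lines through j.\<close>

lemma free_line:
  assumes "j \<in> P" "i \<noteq> j" "k \<noteq> j"
  obtains m where "thru j m" "\<not> thru i m" "\<not> thru k m"
proof -
  obtain a b c where abc: "{l. thru j l} = {a, b, c}" "a \<noteq> b" "b \<noteq> c" "a \<noteq> c"
    using three[OF assms(1)] by (auto simp: card_3_iff)
  then have "thru j a" "thru j b" "thru j c" by auto
  then show ?thesis using abc assms linear[of i _ j] linear[of k _ j] that by metis
qed

text \<open>Vectors of sum 0 act on a fibre: adding one preserves the parity condition, and
  \<open>point_ex\<close> supplies the image.\<close>

lemma translation:
  assumes "x \<in> V" "(\<Sum>l | thru (ty x) l. t l) = 0"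
  obtains y where "y \<in> V" "ty y = ty x" "\<And>l. thru (ty x) l \<Longrightarrow> h l y = h l x + t l"
proof -
  have "(\<Sum>l | thru (ty x) l. h l x + t l) = 0"
    using assms h_sum by (simp add: sum.distrib)
  from point_ex[OF ty_P[OF assms(1)] this] show ?thesis using that by blast
qed

text \<open>Within a fibre \<open>flip\<close> is the identity. Otherwise \<open>x\<close> is kept
  and \<open>y\<close> is translated by the flipping bits, a line through the fibre of
  \<open>y\<close> that misses the fibre of \<open>x\<close> absorbing the parity. Flipping thus
  permutes the colours that occur.\<close>

lemma flip_realizable:
  assumes "x \<in> V" "y \<in> V"
  obtains z where "z \<in> V" "color x z = flip d (color x y)"
proof (cases "ty x = ty y")
  case True
  then show ?thesis using that[of y] assms by (simp add: color_eq_flip_iff bit_add_self add.assoc)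
next
  case False
  obtain m where m: "thru (ty y) m" "\<not> thru (ty x) m"
    using free_line[OF ty_P[OF assms(2)] False False] by blast
  obtain t where t: "(\<Sum>l | thru (ty y) l. t l) = 0" "\<And>l. l \<noteq> m \<Longrightarrow> t l = d (ty x) l + d (ty y) l"
    using sum_zero_extend[OF ty_P[OF assms(2)] m(1), of "\<lambda>l. d (ty x) l + d (ty y) l"] by blast
  obtain z where z: "z \<in> V" "ty z = ty y" "\<And>l. thru (ty y) l \<Longrightarrow> h l z = h l y + t l"
    using translation[OF assms(2) t(1)] by blast
  have "color x z = flip d (color x y)"
    unfolding color_eq_flip_iff
  proof (intro conjI allI impI)
    fix l assume l: "thru (ty x) l" "thru (ty z) l"
    then have "l \<noteq> m" using m by blast
    then show "h l x + h l z = h l x + h l y + d (ty x) l + d (ty z) l"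
      using l z(2,3) t(2) by (simp add: add.assoc)
  qed (use z in simp_all)
  then show ?thesis using that z by blast
qed

text \<open>The vector t is the translation of the fibre over j that turns colours towards u and v
  into flipped colours towards u' and v'. If j is the fibre of u or v, all three values are
  prescribed, and they add up to 0 because the points have coordinate sum 0 and the values of d
  cancel. Otherwise u and v constrain at most one line each, and a third line is free.\<close>

lemma flip_translation:
  assumes uv: "u \<in> V" "v \<in> V" "u' \<in> V" "v' \<in> V"
    and eq: "color u' v' = flip d (color u v)" and j: "j \<in> P"
  obtains t where "(\<Sum>l | thru j l. t l) = 0"
    "\<And>l. thru j l \<Longrightarrow> thru (ty u) l \<Longrightarrow> t l = h l u + h l u' + d (ty u) l + d j l"
    "\<And>l. thru j l \<Longrightarrow> thru (ty v) l \<Longrightarrow> t l = h l v + h l v' + d (ty v) l + d j l"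
proof -
  have eq': "ty u' = ty u" "ty v' = ty v" "\<And>l. thru (ty u) l \<Longrightarrow> thru (ty v) l \<Longrightarrow>
      h l u' + h l v' = h l u + h l v + d (ty u) l + d (ty v) l"
    using eq by (auto simp: color_eq_flip_iff)
  \<comment> \<open>On a line through both end fibres the demands of u and v coincide: this is the
    equation of colours, rearranged.\<close>
  have eq'': "h l u + h l u' + d (ty u) l + e = h l v + h l v' + d (ty v) l + e"
    if "thru (ty u) l" "thru (ty v) l" for l e
    using eq'(3)[OF that] unfolding bit_add_eq_iff[of "h l u'"] by (simp add: bit_simps)
  consider "ty u = j" | "ty v = j" | "ty u \<noteq> j" "ty v \<noteq> j" by blast
  then show ?thesis
  proof cases
    case 1
    have "(\<Sum>l | thru j l. h l u + h l u' + d (ty u) l + d j l) = 0"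
      using h_sum[OF uv(1)] h_sum[OF uv(3)] 1 eq' by (simp add: sum.distrib add.assoc bit_add_self)
    then show ?thesis
      using eq''[of _ "d j _"] 1 by (intro that[of "\<lambda>l. h l u + h l u' + d (ty u) l + d j l"]) auto
  next
    case 2
    have "(\<Sum>l | thru j l. h l v + h l v' + d (ty v) l + d j l) = 0"
      using h_sum[OF uv(2)] h_sum[OF uv(4)] 2 eq' by (simp add: sum.distrib add.assoc bit_add_self)
    then show ?thesis
      using eq''[of _ "d j _"] 2 by (intro that[of "\<lambda>l. h l v + h l v' + d (ty v) l + d j l"]) auto
  next
    case 3
    obtain m where m: "thru j m" "\<not> thru (ty u) m" "\<not> thru (ty v) m"
      using free_line[OF j 3] by blast
    define r where "r l = (if thru (ty u) l then h l u + h l u' + d (ty u) l + d j l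
      else h l v + h l v' + d (ty v) l + d j l)" for l
    obtain t where t: "(\<Sum>l | thru j l. t l) = 0" "\<And>l. l \<noteq> m \<Longrightarrow> t l = r l"
      using sum_zero_extend[OF j m(1), of r] by blast
    have "t l = r l" if "thru (ty u) l \<or> thru (ty v) l" for l
      using that m t(2) by (cases "l = m") auto
    then show ?thesis using t(1) eq'' by (intro that[of t]) (auto simp: r_def)
  qed
qed

text \<open>Translating the middle fibre maps the paths from u to v bijectively to those from u' to
  v'. With d = 0 this is coherence; for general d it is the invariance of intersection numbers under
  flips.\<close>

lemma card_paths_flip:
  assumes uv: "u \<in> V" "v \<in> V" "u' \<in> V" "v' \<in> V"
    and eq: "color u' v' = flip d (color u v)"
    and r: "r = color a b" and s: "s = color a' b'" and b: "b \<in> V"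
  shows "card {w \<in> V. color u w = r \<and> color w v = s} =
    card {w \<in> V. color u' w = flip d r \<and> color w v' = flip d s}" (is "card ?A = card ?B")
proof -
  define j where "j = ty b"
  have j: "j \<in> P" using b ty_P by (simp add: j_def)
  have eq': "ty u' = ty u" "ty v' = ty v" using eq by (auto simp: color_eq_flip_iff)
  obtain t where t: "(\<Sum>l | thru j l. t l) = 0"
    "\<And>l. thru j l \<Longrightarrow> thru (ty u) l \<Longrightarrow> t l = h l u + h l u' + d (ty u) l + d j l"
    "\<And>l. thru j l \<Longrightarrow> thru (ty v) l \<Longrightarrow> t l = h l v + h l v' + d (ty v) l + d j l"
    using flip_translation[OF uv eq j] by metis
  have "\<forall>x. \<exists>y. x \<in> V \<and> ty x = j \<longrightarrow> y \<in> V \<and> ty y = j \<and> (\<forall>l. thru j l \<longrightarrow> h l y = h l x + t l)"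
    using translation[of _ t] t(1) by metis
  then obtain g where g: "\<And>x. x \<in> V \<Longrightarrow> ty x = j \<Longrightarrow> g x \<in> V"
    "\<And>x. x \<in> V \<Longrightarrow> ty x = j \<Longrightarrow> ty (g x) = j"
    "\<And>x l. x \<in> V \<Longrightarrow> ty x = j \<Longrightarrow> thru j l \<Longrightarrow> h l (g x) = h l x + t l"
    by metis
  \<comment> \<open>In characteristic 2 a translation is its own inverse, so \<open>g\<close>
    witnesses both directions of the bijection.\<close>
  have gg: "g (g x) = x" if "x \<in> V" "ty x = j" for x
    using that by (intro point_eq) (auto simp: g add.assoc bit_add_self)
  have tyA: "ty x = j" if "x \<in> ?A" for x
    using that r by (auto simp: color_eq_color_iff j_def)
  have tyB: "ty x = j" if "x \<in> ?B" for x
    using that r by (auto simp: color_eq_flip_iff j_def)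
  have "bij_betw g ?A ?B"
  proof (rule bij_betw_byWitness[where f' = g])
    show "g ` ?A \<subseteq> ?B"
    proof
      fix y assume "y \<in> g ` ?A"
      then obtain w where w: "w \<in> V" "color u w = r" "color w v = s" "y = g w"
        by auto
      then have wj: "ty w = j" using tyA by auto
      have "color u' (g w) = flip d (color u w)" "color (g w) v' = flip d (color w v)"
        using w(1) wj by (auto simp: color_eq_flip_iff g eq' t bit_simps)
      then show "y \<in> ?B" using w wj g by auto
    qed
    show "g ` ?B \<subseteq> ?A"
    proof
      fix y assume "y \<in> g ` ?B"
      then obtain w where w: "w \<in> V" "color u' w = flip d r" "color w v' = flip d s" "y = g w"
        by auto
      then have wj: "ty w = j" using tyB by auto
      have "r = flip d (color u' w)" "s = flip d (color w v')"
        using w r s flip_flip by auto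
      moreover have "color u (g w) = flip d (color u' w)" "color (g w) v = flip d (color w v')"
        using w(1) wj by (auto simp: color_eq_flip_iff g eq' t bit_simps)
      ultimately show "y \<in> ?A" using w wj g by auto
    qed
  qed (use gg tyA tyB in auto)
  then show ?thesis by (rule bij_betw_same_card)
qed

section \<open>Coherence of the partition into colour classes\<close>

lemma mem_color_class [simp]:
  "(x, y) \<in> color_class t \<longleftrightarrow> x \<in> V \<and> y \<in> V \<and> color x y = t"
  by (simp add: color_class_def)

lemma color_class_in: "x \<in> V \<Longrightarrow> y \<in> V \<Longrightarrow> color_class (color x y) \<in> classes"
  by (auto simp: classes_def)

lemma classesE:
  assumes "R \<in> classes"
  obtains x y where "x \<in> V" "y \<in> V" "R = color_class (color x y)"
  using assms by (auto simp: classes_def)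

lemma paths_eq:
  "{w. (u, w) \<in> color_class r \<and> (w, v) \<in> color_class s} =
    (if u \<in> V \<and> v \<in> V then {w \<in> V. color u w = r \<and> color w v = s} else {})"
  by auto

lemma color_class_eq_iff:
  "x \<in> V \<Longrightarrow> y \<in> V \<Longrightarrow> color_class (color x y) = color_class t \<longleftrightarrow> color x y = t"
  by (metis mem_color_class)

lemma color_self_eqD:
  assumes "x \<in> V" "y \<in> V" "color x y = color z z"
  shows "x = y"
proof (rule point_eq)
  show "h l x = h l y" if "thru (ty x) l" for l
    using assms(3) that by (cases "h l x"; cases "h l y") (auto simp: color_eq_color_iff bit_add_self)
qed (use assms in \<open>auto simp: color_eq_color_iff\<close>)

lemma color_swap: "color x y = color x' y' \<longleftrightarrow> color y x = color y' x'"
  by (auto simp: color_eq_color_iff add.commute)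

lemma coherent_classes: "coherent_configuration V classes"
  unfolding coherent_configuration_def
proof (intro conjI ballI impI)
  show "partition_on (V \<times> V) classes"
  proof (rule partition_onI)
    fix p q assume "p \<in> classes" "q \<in> classes" "p \<noteq> q"
    then show "disjnt p q" by (auto simp: classes_def disjnt_def)
  next
    show "\<Union> classes = V \<times> V"
    proof
      show "V \<times> V \<subseteq> \<Union> classes"
      proof clarify
        fix x y assume "x \<in> V" "y \<in> V"
        then show "(x, y) \<in> \<Union> classes"
          by (intro UnionI[OF color_class_in[of x y]]) simp_all
      qed
    qed (auto simp: classes_def)
    show "{} \<notin> classes"
    proof
      assume "{} \<in> classes"
      then obtain x y where xy: "x \<in> V" "y \<in> V" "{} = color_class (color x y)" by (rule classesE)
      have "(x, y) \<in> color_class (color x y)" using xy(1,2) by simp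
      then show False unfolding xy(3)[symmetric] by simp
    qed
  qed
  show "R \<subseteq> Id" if R: "R \<in> classes" "\<exists>u. (u, u) \<in> R" for R
  proof -
    obtain x y where "R = color_class (color x y)" using R(1) by (rule classesE)
    moreover obtain u where "(u, u) \<in> R" using R(2) by blast
    ultimately have "R = color_class (color u u)" by simp
    then show ?thesis by (auto dest: color_self_eqD)
  qed
  show "R\<inverse> \<in> classes" if R: "R \<in> classes" for R
  proof -
    obtain x y where xy: "x \<in> V" "y \<in> V" "R = color_class (color x y)" using R by (rule classesE)
    then have "R\<inverse> = color_class (color y x)" by (auto simp: color_swap[of _ _ x y])
    then show ?thesis using color_class_in xy by simp
  qed
  show "\<exists>p. \<forall>(u, v)\<in>T. card {w. (u, w) \<in> R \<and> (w, v) \<in> S} = p"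
    if RST: "R \<in> classes" "S \<in> classes" "T \<in> classes" for R S T
  proof -
    obtain a b where ab: "a \<in> V" "b \<in> V" "R = color_class (color a b)" using RST(1) by (rule classesE)
    obtain a' b' where ab': "a' \<in> V" "b' \<in> V" "S = color_class (color a' b')" using RST(2) by (rule classesE)
    obtain u v where uv: "u \<in> V" "v \<in> V" "T = color_class (color u v)" using RST(3) by (rule classesE)
    have "card {w. (u', w) \<in> R \<and> (w, v') \<in> S} = card {w. (u, w) \<in> R \<and> (w, v) \<in> S}"
      if "(u', v') \<in> T" for u' v'
    proof -
      have uv': "u' \<in> V" "v' \<in> V" "color u' v' = color u v" using that uv by auto
      then show ?thesis
        using card_paths_flip[of u v u' v' "\<lambda>_ _. 0" "color a b" a b "color a' b'" a' b'] uv ab ab'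
        by (simp add: flip_zero paths_eq del: mem_color_class)
    qed
    then show ?thesis by blast
  qed
qed (rule finite_V)


section \<open>Flips as algebraic isomorphisms, and what their being induced implies\<close>

definition flip_class :: "('p \<Rightarrow> 'l \<Rightarrow> bit) \<Rightarrow> ('a \<times> 'a) set \<Rightarrow> ('a \<times> 'a) set" where
  "flip_class d R = color_class (flip d (case_prod color (SOME p. p \<in> R)))"

text \<open>A class is nonempty and its members share one colour, so whichever member
  \<open>SOME\<close> picks yields the same result.\<close>

lemma flip_class_color_class:
  assumes "x \<in> V" "y \<in> V"
  shows "flip_class d (color_class (color x y)) = color_class (flip d (color x y))"
proof -
  have "p \<in> color_class t \<Longrightarrow> case_prod color p = t" for p t
    by (cases p) simp
  moreover have "(SOME p. p \<in> color_class (color x y)) \<in> color_class (color x y)"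
    by (rule someI[of _ "(x, y)"]) (simp add: assms)
  ultimately have "case_prod color (SOME p. p \<in> color_class (color x y)) = color x y" .
  then show ?thesis by (simp add: flip_class_def)
qed

lemma flip_class_in: "R \<in> classes \<Longrightarrow> flip_class d R \<in> classes"
  by (metis classesE flip_class_color_class flip_realizable color_class_in)

lemma flip_class_flip_class:
  assumes "R \<in> classes"
  shows "flip_class d (flip_class d R) = R"
proof -
  obtain x y where xy: "x \<in> V" "y \<in> V" "R = color_class (color x y)" using assms by (rule classesE)
  obtain z where z: "z \<in> V" "color x z = flip d (color x y)"
    using flip_realizable[OF xy(1,2)] by blast
  have "flip_class d (flip_class d R) = flip_class d (color_class (color x z))"
    using xy z flip_class_color_class by simp
  also have "\<dots> = color_class (flip d (color x z))"
    using xy(1) z(1) by (rule flip_class_color_class)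
  finally show ?thesis by (simp add: z flip_flip xy)
qed

lemma algebraic_isomorphism_flip_class: "algebraic_isomorphism classes classes (flip_class d)"
  unfolding algebraic_isomorphism_def
proof (intro conjI ballI)
  show "bij_betw (flip_class d) classes classes"
    by (rule bij_betw_byWitness[where f' = "flip_class d"])
      (auto simp: flip_class_flip_class flip_class_in)
  fix R S T assume RST: "R \<in> classes" "S \<in> classes" "T \<in> classes"
  obtain a b where ab: "a \<in> V" "b \<in> V" "R = color_class (color a b)" using RST(1) by (rule classesE)
  obtain a' b' where ab': "a' \<in> V" "b' \<in> V" "S = color_class (color a' b')" using RST(2) by (rule classesE)
  obtain u v where uv: "u \<in> V" "v \<in> V" "T = color_class (color u v)" using RST(3) by (rule classesE)
  \<comment> \<open>A sample pair of the flipped relation with the same first point; path counts at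
    the pairs (u, v) and (u, v') are compared.\<close>
  obtain v' where v': "v' \<in> V" "color u v' = flip d (color u v)"
    using flip_realizable[OF uv(1,2)] by blast
  have "intersection_number R S T = card {w. (u, w) \<in> R \<and> (w, v) \<in> S}"
    using uv by (intro intersection_number_eq[OF coherent_classes RST]) simp
  also have "\<dots> = card {w. (u, w) \<in> flip_class d R \<and> (w, v') \<in> flip_class d S}"
    using card_paths_flip[OF uv(1,2) uv(1) v' refl refl ab(2), of a a' b'] ab ab' uv v'
    by (simp add: flip_class_color_class paths_eq del: mem_color_class)
  also have "\<dots> = intersection_number (flip_class d R) (flip_class d S) (flip_class d T)"
    using uv v' RST[THEN flip_class_in]
    by (intro intersection_number_eq[OF coherent_classes, symmetric]) (auto simp: flip_class_color_class)
  finally show "intersection_number R S T =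
    intersection_number (flip_class d R) (flip_class d S) (flip_class d T)" .
qed

lemma line_ex: "i \<in> P \<Longrightarrow> \<exists>l. thru i l"
  using three[of i] by (metis Collect_empty_eq card.empty zero_neq_numeral)

text \<open>The map inducing the flip moves each base point \<open>b i\<close> by a vector of sum 0.
  Adding \<open>d i\<close> to this vector gives bits that agree for all points of a line, hence a
  function of the lines, and its sum over the lines through i is the sum of
  \<open>d i\<close>.\<close>

lemma separable_imp_solvable:
  assumes sep: "separable V classes"
  shows "\<exists>e. \<forall>i\<in>P. (\<Sum>l | thru i l. e l) = (D i :: bit)"
proof -
  obtain m where m: "\<And>i. i \<in> P \<Longrightarrow> thru i (m i)" using line_ex by metis
  \<comment> \<open>Only the sums of \<open>d i\<close> matter, so all of \<open>D i\<close> is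
    placed on one chosen line through i.\<close>
  define d where "d i l = (if l = m i then D i else 0)" for i l
  have d_sum: "(\<Sum>l | thru i l. d i l) = D i" if "i \<in> P" for i
    using that m finite_thru[OF that] by (simp add: d_def sum.delta')
  obtain \<phi> where phi: "induced_by V classes V (flip_class d) \<phi>"
    using separable_any_target[OF sep coherent_classes algebraic_isomorphism_flip_class] by blast
  have phi_V: "\<phi> x \<in> V" if "x \<in> V" for x
    using phi that by (auto simp: induced_by_def dest: bij_betw_apply)
  have phi_color: "color (\<phi> x) (\<phi> y) = flip d (color x y)" if xy: "x \<in> V" "y \<in> V" for x y
  proof -
    have "map_prod \<phi> \<phi> ` color_class (color x y) = color_class (flip d (color x y))"
      using phi color_class_in[OF xy] flip_class_color_class[OF xy] by (simp add: induced_by_def)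
    moreover have "map_prod \<phi> \<phi> (x, y) \<in> map_prod \<phi> \<phi> ` color_class (color x y)"
      using xy by (intro imageI) simp
    ultimately show ?thesis by simp
  qed
  have phi_ty: "ty (\<phi> x) = ty x" if "x \<in> V" for x
    using phi_color[OF that that] by (simp add: color_eq_flip_iff)
  have "\<exists>x\<in>V. ty x = i" if "i \<in> P" for i
    using point_ex[OF that, of "\<lambda>_. 0"] by auto
  then obtain b where b: "\<And>i. i \<in> P \<Longrightarrow> b i \<in> V" "\<And>i. i \<in> P \<Longrightarrow> ty (b i) = i" by metis
  define t where "t i l = h l (\<phi> (b i)) + h l (b i) + d i l" for i l
  have t_eq: "t i l = t j l" if "i \<in> P" "j \<in> P" "thru i l" "thru j l" for i j l
  proof -
    have "h l (\<phi> (b i)) + h l (\<phi> (b j)) = h l (b i) + h l (b j) + d i l + d j l"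
      using phi_color[of "b i" "b j"] that b phi_ty by (simp add: color_eq_flip_iff)
    then show ?thesis unfolding t_def bit_add_eq_iff[of "h l (\<phi> (b i))"] by (simp add: bit_simps)
  qed
  \<comment> \<open>The value can be read off at any point of the line, by \<open>t_eq\<close>; a
    line without points gets an arbitrary value and enters no sum.\<close>
  define e where "e l = t (SOME i. i \<in> P \<and> thru i l) l" for l
  have e: "e l = t i l" if "i \<in> P" "thru i l" for i l
    unfolding e_def using someI[of "\<lambda>i. i \<in> P \<and> thru i l" i] that by (intro t_eq) auto
  have "(\<Sum>l | thru i l. e l) = D i" if i: "i \<in> P" for i
  proof -
    have "(\<Sum>l | thru i l. e l) = (\<Sum>l | thru i l. t i l)"
      using e i by (intro sum.cong) auto
    also have "\<dots> = D i"
      using h_sum[of "b i"] h_sum[of "\<phi> (b i)"] d_sum b i phi_V phi_ty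
      by (simp add: t_def sum.distrib)
    finally show ?thesis .
  qed
  then show ?thesis by blast
qed

section \<open>Reconstructing coordinates on the target of an algebraic isomorphism\<close>

lemma color_coordinates:
  assumes "t = color u v"
  shows "t = (fst t, fst (snd t), snd (snd t))" "fst t = ty u" "fst (snd t) = ty v"
    "snd (snd t) l = (if thru (ty u) l \<and> thru (ty v) l then h l u + h l v else 0)"
  using assms by (simp_all add: color_def)

text \<open>Here \<open>k\<close> colours the pairs of a target without coordinates, and
  \<open>triangle\<close> says that each triple of its points looks like a triple in
  \<open>V\<close>. Of the remaining conditions, \<open>nonempty\<close> provides a base point in
  every fibre, \<open>loop_eq\<close> gives injectivity and \<open>extend\<close>
  surjectivity.\<close>

lemma realize_coloring:
  assumes k_color: "\<And>x y. x \<in> V' \<Longrightarrow> y \<in> V' \<Longrightarrow> \<exists>u\<in>V. \<exists>v\<in>V. k x y = color u v"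
    and triangle: "\<And>x y z. x \<in> V' \<Longrightarrow> y \<in> V' \<Longrightarrow> z \<in> V' \<Longrightarrow>
      \<exists>u\<in>V. \<exists>v\<in>V. \<exists>w\<in>V. k x y = color u v \<and> k y z = color v w \<and> k x z = color u w"
    and extend: "\<And>x u v. x \<in> V' \<Longrightarrow> u \<in> V \<Longrightarrow> v \<in> V \<Longrightarrow> k x x = color u u \<Longrightarrow>
      \<exists>y\<in>V'. k x y = color u v"
    and loop: "\<And>x. x \<in> V' \<Longrightarrow> \<exists>u\<in>V. k x x = color u u"
    and loop_eq: "\<And>x y u. x \<in> V' \<Longrightarrow> y \<in> V' \<Longrightarrow> u \<in> V \<Longrightarrow> k x y = color u u \<Longrightarrow> x = y"
    and nonempty: "\<And>u. u \<in> V \<Longrightarrow> \<exists>x\<in>V'. k x x = color u u"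
    and solvable: "\<And>D. \<exists>e. \<forall>i\<in>P. (\<Sum>l | thru i l. e l) = (D i :: bit)"
  shows "\<exists>\<psi>. bij_betw \<psi> V' V \<and> (\<forall>x\<in>V'. \<forall>y\<in>V'. k x y = color (\<psi> x) (\<psi> y))"
proof -
  define \<tau> where "\<tau> x = fst (k x x)" for x
  define \<delta> where "\<delta> x y = snd (snd (k x y))" for x y
  have tau_loop: "\<tau> x = ty u" if "k x x = color u u" for x u
    using that by (simp add: \<tau>_def color_def)
  have tau_P: "\<tau> x \<in> P" if "x \<in> V'" for x
    using loop[OF that] tau_loop ty_P by metis
  have k_eq: "k x y = (\<tau> x, \<tau> y, \<delta> x y)" if xy: "x \<in> V'" "y \<in> V'" for x y
  proof -
    obtain p q r where 2: "k x x = color p q" "k x y = color q r"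
      using triangle[OF xy(1) xy] by blast
    obtain p' q' r' where 3: "k x y = color p' q'" "k y y = color q' r'"
      using triangle[OF xy xy(2)] by blast
    have "fst (k x y) = ty q" "fst (snd (k x y)) = ty q'"
      using color_coordinates[OF 2(2)] color_coordinates[OF 3(1)] by simp_all
    moreover have "ty q' = \<tau> y" using color_coordinates[OF 3(2)] by (simp add: \<tau>_def)
    moreover have "ty q = \<tau> x"
    proof -
      obtain c where "k x x = color c c" using loop xy by blast
      then show ?thesis using 2(1) by (simp add: \<tau>_def color_def)
    qed
    ultimately show ?thesis unfolding \<delta>_def by (metis prod.collapse)
  qed
  have delta_color: "ty u = \<tau> x \<and> ty v = \<tau> y \<and>
      \<delta> x y = (\<lambda>l. if thru (\<tau> x) l \<and> thru (\<tau> y) l then h l u + h l v else 0)"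
    if "x \<in> V'" "y \<in> V'" "k x y = color u v" for x y u v
    using k_eq[of x y] that unfolding color_def by auto
  \<comment> \<open>The cocycle identity on a line: in a matching triple of \<open>V\<close> the
    coordinate of the middle point occurs twice.\<close>
  have delta_add: "\<delta> x y l + \<delta> y z l = \<delta> x z l"
    if xyz: "x \<in> V'" "y \<in> V'" "z \<in> V'" and l: "thru (\<tau> x) l" "thru (\<tau> y) l" "thru (\<tau> z) l" for x y z l
  proof -
    obtain u v w where "k x y = color u v" "k y z = color v w" "k x z = color u w"
      using triangle[OF xyz] by blast
    then show ?thesis
      using xyz l delta_color[of x y u v] delta_color[of y z v w] delta_color[of x z u w]
      by (simp add: bit_simps)
  qed
  \<comment> \<open>Within a fibre every line contributes a bit, so the parity condition of
    \<open>V\<close> carries over to differences.\<close>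
  have delta_sum: "(\<Sum>l | thru (\<tau> x) l. \<delta> x y l) = 0"
    if xy: "x \<in> V'" "y \<in> V'" and eq: "\<tau> x = \<tau> y" for x y
  proof -
    obtain u v where uv: "u \<in> V" "v \<in> V" "k x y = color u v"
      using k_color[OF xy] by blast
    have "(\<Sum>l | thru (\<tau> x) l. \<delta> x y l) = (\<Sum>l | thru (\<tau> x) l. h l u + h l v)"
      using delta_color[OF xy uv(3)] eq by (intro sum.cong) auto
    also have "\<dots> = 0"
      using h_sum[OF uv(1)] h_sum[OF uv(2)] delta_color[OF xy uv(3)] eq by (simp add: sum.distrib)
    finally show ?thesis .
  qed
  have "\<exists>x\<in>V'. \<tau> x = i" if i: "i \<in> P" for i
  proof -
    obtain u where "u \<in> V" "ty u = i" using point_ex[OF i, of "\<lambda>_. 0"] by auto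
    then show ?thesis using nonempty[of u] tau_loop by blast
  qed
  then obtain b where b: "\<And>i. i \<in> P \<Longrightarrow> b i \<in> V'" "\<And>i. i \<in> P \<Longrightarrow> \<tau> (b i) = i" by metis
  \<comment> \<open>A reference point on each line. The bit \<open>c i l\<close> compares the base
    points over i and \<open>p l\<close>, so by the cocycle identity \<open>c i l + c j l\<close> is
    the bit between \<open>b i\<close> and \<open>b j\<close>. The sum of \<open>c i\<close> may be
    nonzero; adding \<open>e\<close>, which cancels in every such pair, repairs the parity.\<close>
  define p where "p l = (SOME i. i \<in> P \<and> thru i l)" for l
  have p: "p l \<in> P" "thru (p l) l" if "i \<in> P" "thru i l" for i l
    using someI[of "\<lambda>i. i \<in> P \<and> thru i l" i] that by (simp_all add: p_def)
  define c where "c i l = \<delta> (b i) (b (p l)) l" for i l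
  obtain e where e: "\<And>i. i \<in> P \<Longrightarrow> (\<Sum>l | thru i l. e l) = (\<Sum>l | thru i l. c i l)"
    using solvable[of "\<lambda>i. \<Sum>l | thru i l. c i l"] by blast
  define s where "s i l = c i l + e l" for i l
  have s_sum: "(\<Sum>l | thru i l. s i l) = 0" if "i \<in> P" for i
    using e[OF that] by (simp add: s_def sum.distrib bit_add_self)
  have s_eq: "s i l + s j l = \<delta> (b i) (b j) l" if ij: "i \<in> P" "j \<in> P" "thru i l" "thru j l" for i j l
  proof -
    have "\<delta> (b i) (b j) l + c j l = c i l"
      unfolding c_def using ij b p[OF ij(1,3)] by (intro delta_add) auto
    then show ?thesis
      unfolding s_def bit_add_eq_iff[of "\<delta> (b i) (b j) l"] by (simp add: bit_simps)
  qed
  \<comment> \<open>The vector \<open>s i\<close> serves as the coordinates of the image of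
    \<open>b i\<close>; every other point of the fibre is placed by its difference from the base
    point.\<close>
  have "\<exists>y\<in>V. ty y = \<tau> x \<and> (\<forall>l. thru (\<tau> x) l \<longrightarrow> h l y = \<delta> (b (\<tau> x)) x l + s (\<tau> x) l)"
    if x: "x \<in> V'" for x
  proof (rule point_ex[OF tau_P[OF x]])
    show "(\<Sum>l | thru (\<tau> x) l. \<delta> (b (\<tau> x)) x l + s (\<tau> x) l) = 0"
      using delta_sum[of "b (\<tau> x)" x] s_sum b tau_P x by (simp add: sum.distrib)
  qed
  then obtain \<psi> where psi: "\<And>x. x \<in> V' \<Longrightarrow> \<psi> x \<in> V" "\<And>x. x \<in> V' \<Longrightarrow> ty (\<psi> x) = \<tau> x"
    "\<And>x l. x \<in> V' \<Longrightarrow> thru (\<tau> x) l \<Longrightarrow> h l (\<psi> x) = \<delta> (b (\<tau> x)) x l + s (\<tau> x) l"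
    by metis
  have k_psi: "k x y = color (\<psi> x) (\<psi> y)" if xy: "x \<in> V'" "y \<in> V'" for x y
  proof -
    obtain u v where uv: "k x y = color u v" using k_color[OF xy] by blast
    have "h l (\<psi> x) + h l (\<psi> y) = \<delta> x y l" if l: "thru (\<tau> x) l" "thru (\<tau> y) l" for l
    proof -
      let ?i = "\<tau> x" and ?j = "\<tau> y"
      have 1: "s ?i l = \<delta> (b ?i) (b ?j) l + s ?j l"
        using s_eq[OF tau_P[OF xy(1)] tau_P[OF xy(2)] l] unfolding bit_add_eq_iff[of "s ?i l"] by (simp add: bit_simps)
      have 2: "\<delta> (b ?i) x l + \<delta> x y l = \<delta> (b ?i) y l"
        using xy l b tau_P by (intro delta_add) auto
      have 3: "\<delta> (b ?i) (b ?j) l + \<delta> (b ?j) y l = \<delta> (b ?i) y l"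
        using xy l b tau_P by (intro delta_add) auto
      show ?thesis
        using 2 unfolding 3[symmetric] psi(3)[OF xy(1) l(1)] psi(3)[OF xy(2) l(2)] 1 bit_add_eq_iff
        by (simp add: bit_simps)
    qed
    then have "color (\<psi> x) (\<psi> y) = (\<tau> x, \<tau> y, \<delta> x y)"
      using delta_color[OF xy uv] psi(2) xy by (simp add: color_eq_iff)
    then show ?thesis using k_eq[OF xy] by simp
  qed
  have "bij_betw \<psi> V' V"
  proof (rule bij_betwI')
    show "\<psi> x = \<psi> y \<longleftrightarrow> x = y" if "x \<in> V'" "y \<in> V'" for x y
      using k_psi[OF that] loop_eq[OF that psi(1)[OF that(1)]] by auto
    \<comment> \<open>A point is determined by its colour with any point of its own fibre, so
      extending from the base point reaches \<open>v\<close>.\<close>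
    show "\<exists>x\<in>V'. v = \<psi> x" if v: "v \<in> V" for v
    proof -
      let ?b = "b (ty v)"
      have bV: "?b \<in> V'" "\<tau> ?b = ty v" using b ty_P[OF v] by auto
      obtain y where y: "y \<in> V'" "k ?b y = color (\<psi> ?b) v"
        using extend[OF bV(1) psi(1)[OF bV(1)] v k_psi[OF bV(1) bV(1)]] by blast
      have eq: "color (\<psi> ?b) (\<psi> y) = color (\<psi> ?b) v" using k_psi[OF bV(1) y(1)] y by simp
      have "v = \<psi> y"
      proof (rule point_eq)
        show "h l v = h l (\<psi> y)" if "thru (ty v) l" for l
          using eq that psi(2)[OF bV(1)] bV(2) by (auto simp: color_eq_color_iff)
      qed (use eq v y psi in \<open>auto simp: color_eq_color_iff\<close>)
      then show ?thesis using y by blast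
    qed
  qed (rule psi)
  then show ?thesis using k_psi by blast
qed

text \<open>The relations of the target are pulled back along \<open>f\<close> to a colouring
  \<open>k\<close> of its pairs. Since a path with prescribed colours exists in the target exactly
  when it exists in \<open>V\<close>, the conditions of \<open>realize_coloring\<close> hold, and
  the inverse of the resulting bijection induces \<open>f\<close>.\<close>

lemma solvable_imp_separable:
  assumes solvable: "\<And>D. \<exists>e. \<forall>i\<in>P. (\<Sum>l | thru i l. e l) = (D i :: bit)"
  shows "separable V classes"
  unfolding separable_def
proof (intro allI impI)
  fix V' :: "nat set" and C' f
  assume C': "coherent_configuration V' C'" and f: "algebraic_isomorphism classes C' f"
  let ?f = "\<lambda>t. f (color_class t)"
  have bij: "bij_betw f classes C'" using f by (simp add: algebraic_isomorphism_def)
  have fC: "?f (color u v) \<in> C'" if "u \<in> V" "v \<in> V" for u v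
    using bij color_class_in[OF that] by (auto dest: bij_betw_apply)
  have part: "\<Union> C' = V' \<times> V'" "disjoint C'" "{} \<notin> C'"
    and loops: "\<And>R u. R \<in> C' \<Longrightarrow> (u, u) \<in> R \<Longrightarrow> R \<subseteq> Id"
    using C' by (auto simp: coherent_configuration_def partition_on_def)
  have f_V': "x \<in> V'" "y \<in> V'" if "(x, y) \<in> ?f (color u v)" "u \<in> V" "v \<in> V" for x y u v
    using that fC part(1) by blast+
  have f_unique: "color u v = color u' v'"
    if "(x, y) \<in> ?f (color u v)" "(x, y) \<in> ?f (color u' v')" "u \<in> V" "v \<in> V" "u' \<in> V" "v' \<in> V"
    for x y u v u' v'
  proof -
    have "?f (color u v) = ?f (color u' v')"
      using that fC part(2) by (meson disjointD disjoint_iff)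
    then have "color_class (color u v) = color_class (color u' v')"
      using bij color_class_in that by (meson bij_betw_imp_inj_on inj_on_eq_iff)
    then show ?thesis using that color_class_eq_iff by simp
  qed
  have "\<exists>t. (\<exists>u\<in>V. \<exists>v\<in>V. t = color u v) \<and> (x, y) \<in> ?f t" if xy: "x \<in> V'" "y \<in> V'" for x y
  proof -
    obtain Q where "Q \<in> C'" "(x, y) \<in> Q" using xy part(1) by blast
    then obtain R where R: "R \<in> classes" "(x, y) \<in> f R"
      using bij by (metis bij_betw_imp_surj_on imageE)
    from R(1) obtain u v where "u \<in> V" "v \<in> V" "R = color_class (color u v)" by (rule classesE)
    then show ?thesis using R(2) by blast
  qed
  then obtain k where k_color: "\<And>x y. x \<in> V' \<Longrightarrow> y \<in> V' \<Longrightarrow> \<exists>u\<in>V. \<exists>v\<in>V. k x y = color u v"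
    and k_mem: "\<And>x y. x \<in> V' \<Longrightarrow> y \<in> V' \<Longrightarrow> (x, y) \<in> ?f (k x y)" by metis
  have k_eq: "k x y = color u v" if uv: "u \<in> V" "v \<in> V" and m: "(x, y) \<in> ?f (color u v)" for x y u v
  proof -
    have xy: "x \<in> V'" "y \<in> V'" using f_V' m uv by blast+
    obtain u' v' where "u' \<in> V" "v' \<in> V" "k x y = color u' v'" using k_color[OF xy] by blast
    then show ?thesis using f_unique[of x y u' v' u v] k_mem[OF xy] m uv by simp
  qed
  have paths: "(\<exists>v. v \<in> V \<and> color u v = color a b \<and> color v w = color a' b') \<longleftrightarrow>
      (\<exists>y. y \<in> V' \<and> k x y = color a b \<and> k y z = color a' b')"
    if V: "x \<in> V'" "z \<in> V'" "u \<in> V" "w \<in> V" "a \<in> V" "b \<in> V" "a' \<in> V" "b' \<in> V" and c: "k x z = color u w"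
    for x z u w a b a' b'
  proof -
    have "(\<exists>v. (u, v) \<in> color_class (color a b) \<and> (v, w) \<in> color_class (color a' b')) \<longleftrightarrow>
      (\<exists>y. (x, y) \<in> ?f (color a b) \<and> (y, z) \<in> ?f (color a' b'))"
      using V k_mem[OF V(1,2)] c
      by (intro algebraic_isomorphism_paths[OF coherent_classes C' f, of _ _ "color_class (color u w)"])
        (simp_all add: color_class_in)
    moreover have "(x, y) \<in> ?f (color a b) \<and> (y, z) \<in> ?f (color a' b') \<longleftrightarrow>
      y \<in> V' \<and> k x y = color a b \<and> k y z = color a' b'" for y
      using V k_eq k_mem f_V' by metis
    ultimately show ?thesis using V by auto
  qed
  \<comment> \<open>A pair (u, w) with the colour of (x, z) is fixed; the path through y then forces
    a middle point v in \<open>V\<close>.\<close>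
  have triangle: "\<exists>u\<in>V. \<exists>v\<in>V. \<exists>w\<in>V. k x y = color u v \<and> k y z = color v w \<and> k x z = color u w"
    if xyz: "x \<in> V'" "y \<in> V'" "z \<in> V'" for x y z
  proof -
    obtain u w where uw: "u \<in> V" "w \<in> V" "k x z = color u w" using k_color xyz by blast
    obtain a b where ab: "a \<in> V" "b \<in> V" "k x y = color a b" using k_color xyz by blast
    obtain a' b' where ab': "a' \<in> V" "b' \<in> V" "k y z = color a' b'" using k_color xyz by blast
    have "\<exists>v. v \<in> V \<and> color u v = color a b \<and> color v w = color a' b'"
      unfolding paths[OF xyz(1,3) uw(1,2) ab(1,2) ab'(1,2) uw(3)] using ab ab' xyz by blast
    then obtain v where v: "v \<in> V" "color u v = color a b" "color v w = color a' b'" by blast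
    have "k x y = color u v \<and> k y z = color v w \<and> k x z = color u w"
      using uw ab ab' v by simp
    then show ?thesis using uw v by blast
  qed
  have extend: "\<exists>y\<in>V'. k x y = color u v \<and> k y z = color v w"
    if V: "x \<in> V'" "z \<in> V'" "u \<in> V" "v \<in> V" "w \<in> V" and c: "k x z = color u w" for x z u v w
    using paths[OF V(1,2,3,5) V(3,4) V(4,5) c] V(4) by blast
  have loop_same: "x = y" "k x x = k x y"
    if xy: "x \<in> V'" "y \<in> V'" "z \<in> V'" "k x y = k z z" for x y z
  proof -
    obtain u v where uv: "u \<in> V" "v \<in> V" "k z z = color u v" using k_color xy by blast
    have "?f (color u v) \<subseteq> Id" using loops[OF fC[OF uv(1,2)], of z] k_mem[of z z] uv xy by simp
    then show "x = y" using k_mem[of x y] uv xy by auto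
    then show "k x x = k x y" by simp
  qed
  have loop: "\<exists>u\<in>V. k x x = color u u" if x: "x \<in> V'" for x
  proof -
    obtain u v where uv: "u \<in> V" "v \<in> V" "k x x = color u v" using k_color x by blast
    \<comment> \<open>The path u, u, v in \<open>V\<close> is transported to a path x, y, x. Its
      second edge has the colour of a loop, so y = x, and its first edge shows that the loop at x
      has a loop colour.\<close>
    obtain y where y: "y \<in> V'" "k x y = color u u" "k y x = color u v"
      using extend[OF x x uv(1) uv(1) uv(2) uv(3)] by blast
    have "y = x" using loop_same(1)[OF y(1) x x] y(3) uv(3) by simp
    then show ?thesis using y uv by blast
  qed
  \<comment> \<open>In a triple of \<open>V\<close> that represents x, x, y all three points
    coincide, so (x, y) has the colour of the loop at x.\<close>
  have loop_eq: "x = y" if V: "x \<in> V'" "y \<in> V'" "u \<in> V" and c: "k x y = color u u" for x y u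
  proof -
    obtain p q r where pqr: "p \<in> V" "q \<in> V" "r \<in> V" "k x x = color p q" "k x y = color q r" "k x y = color p r"
      using triangle[OF V(1,1,2)] by blast
    obtain a where "k x x = color a a" using loop V by blast
    then have "p = q" using color_self_eqD pqr by metis
    moreover have "q = r" using color_self_eqD pqr c by metis
    ultimately show ?thesis using loop_same(1)[OF V(1,2) V(1)] pqr by simp
  qed
  have nonempty: "\<exists>x\<in>V'. k x x = color u u" if u: "u \<in> V" for u
  proof -
    obtain x y where xy: "(x, y) \<in> ?f (color u u)" using fC[OF u u] part(3) by (metis ex_in_conv surj_pair)
    then have "x \<in> V'" "y \<in> V'" "k x y = color u u" using f_V' k_eq u by blast+
    then show ?thesis using loop_eq u by blast
  qed
  have extend_loop: "\<exists>y\<in>V'. k x y = color u v"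
    if "x \<in> V'" "u \<in> V" "v \<in> V" "k x x = color u u" for x u v
    using extend[of x x u v u] that by blast
  have "\<exists>\<psi>. bij_betw \<psi> V' V \<and> (\<forall>x\<in>V'. \<forall>y\<in>V'. k x y = color (\<psi> x) (\<psi> y))"
    by (rule realize_coloring; fact k_color triangle extend_loop loop loop_eq nonempty solvable)
  then obtain \<psi> where psi: "bij_betw \<psi> V' V"
    "\<And>x y. x \<in> V' \<Longrightarrow> y \<in> V' \<Longrightarrow> k x y = color (\<psi> x) (\<psi> y)" by blast
  define \<phi> where "\<phi> = inv_into V' \<psi>"
  have phi: "\<phi> u \<in> V'" "\<psi> (\<phi> u) = u" if "u \<in> V" for u
    using psi(1) that unfolding \<phi>_def by (auto simp: bij_betw_def inv_into_into f_inv_into_f)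
  have phi_psi: "\<phi> (\<psi> x) = x" "\<psi> x \<in> V" if "x \<in> V'" for x
    using psi(1) that unfolding \<phi>_def by (auto simp: bij_betw_def)
  have mem: "(x, y) \<in> ?f (color u v) \<longleftrightarrow> x \<in> V' \<and> y \<in> V' \<and> color (\<psi> x) (\<psi> y) = color u v"
    if "u \<in> V" "v \<in> V" for x y u v
    using k_eq[OF that, of x y] k_mem[of x y] f_V'[OF _ that, of x y] psi(2)[of x y] by metis
  have "map_prod \<phi> \<phi> ` R = f R" if R: "R \<in> classes" for R
  proof -
    obtain u v where uv: "u \<in> V" "v \<in> V" "R = color_class (color u v)" using R by (rule classesE)
    show ?thesis
    proof
      show "map_prod \<phi> \<phi> ` R \<subseteq> f R" using mem[OF uv(1,2)] uv phi by auto
      show "f R \<subseteq> map_prod \<phi> \<phi> ` R"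
      proof clarify
        fix x y assume "(x, y) \<in> f R"
        then have "x \<in> V'" "y \<in> V'" "color (\<psi> x) (\<psi> y) = color u v" using mem[OF uv(1,2)] uv(3) by auto
        then have "(\<psi> x, \<psi> y) \<in> R" "(x, y) = map_prod \<phi> \<phi> (\<psi> x, \<psi> y)" using phi_psi uv by auto
        then show "(x, y) \<in> map_prod \<phi> \<phi> ` R" by (metis imageI)
      qed
    qed
  qed
  moreover have "bij_betw \<phi> V V'" unfolding \<phi>_def using psi(1) by (rule bij_betw_inv_into)
  ultimately show "\<exists>\<phi>. induced_by V classes V' f \<phi>" unfolding induced_by_def by blast
qed

theorem separable_iff_solvable:
  "separable V classes \<longleftrightarrow> (\<forall>D. \<exists>e. \<forall>i\<in>P. (\<Sum>l | thru i l. e l) = (D i :: bit))"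
  using separable_imp_solvable solvable_imp_separable by blast

end

section \<open>The incidence matrix of the cyclic configuration modulo 2\<close>

text \<open>Labelling a line by its residue l makes functions of the lines functions of residues and
  the incidence matrix a circulant.\<close>

definition cyclic_line :: "nat \<Rightarrow> nat \<Rightarrow> nat set" where
  "cyclic_line n l = {l, (l + 2) mod n, (l + 3) mod n}"

definition incident :: "nat \<Rightarrow> nat \<Rightarrow> nat \<Rightarrow> bool" where
  "incident n i l \<longleftrightarrow> i < n \<and> l < n \<and> i \<in> cyclic_line n l"

lemma mod_less_double: "m < 2 * n \<Longrightarrow> m mod n = (if m < n then m else m - n)" for m n :: nat
  by (simp add: le_mod_geq)

text \<open>The equations i = l, l + 2, l + 3 are solved for l modulo n; n is added before
  subtracting because subtraction of naturals truncates.\<close>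

lemma lines_through:
  assumes "n \<ge> 7" "i < n"
  shows "{l. incident n i l} = {i, (i + n - 2) mod n, (i + n - 3) mod n}"
  using assms by (auto simp: incident_def cyclic_line_def mod_less_double split: if_splits)

lemma lines_through_distinct:
  fixes i n :: nat
  assumes "n \<ge> 7" "i < n"
  shows "i \<noteq> (i + n - 2) mod n" "i \<noteq> (i + n - 3) mod n" "(i + n - 2) mod n \<noteq> (i + n - 3) mod n"
  using assms by (auto simp: mod_less_double split: if_splits)

lemma sum_lines_through:
  assumes "n \<ge> 7" "i < n"
  shows "(\<Sum>l | incident n i l. e l) = e i + e ((i + n - 2) mod n) + (e ((i + n - 3) mod n) :: bit)"
  using lines_through_distinct[OF assms] by (simp add: lines_through[OF assms] add.assoc)

lemma card_lines_through: "n \<ge> 7 \<Longrightarrow> i < n \<Longrightarrow> card {l. incident n i l} = 3"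
  using lines_through_distinct[of n i] by (simp add: lines_through)

lemma points_on_line:
  assumes "n \<ge> 7" "l < n"
  shows "{i. incident n i l} = {l, (l + 2) mod n, (l + 3) mod n}"
  using assms by (auto simp: incident_def cyclic_line_def)

lemma sum_points_on_line:
  assumes "n \<ge> 7" "l < n"
  shows "(\<Sum>i | incident n i l. y i) = y l + y ((l + 2) mod n) + (y ((l + 3) mod n) :: bit)"
proof -
  have "l \<noteq> (l + 2) mod n" "l \<noteq> (l + 3) mod n" "(l + 2) mod n \<noteq> (l + 3) mod n"
    using assms by (auto simp: mod_less_double split: if_splits)
  then show ?thesis by (simp add: points_on_line[OF assms] add.assoc)
qed

lemma shift_back:
  fixes n :: nat
  assumes "c < n"
  shows "((l + c) mod n + n - c) mod n = l mod n"
proof -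
  have "((l + c) mod n + n - c) mod n = ((l + c) mod n + (n - c)) mod n" using assms by simp
  also have "\<dots> = (l + c + (n - c)) mod n" by (rule mod_add_left_eq)
  also have "l + c + (n - c) = l + n" using assms by simp
  finally show ?thesis by simp
qed

text \<open>The common offset l cancels; the computation passes through the integers to avoid
  truncated subtraction.\<close>

lemma mod_diff_offset:
  fixes a b l n :: nat
  assumes "a < n"
  shows "((l + b) mod n + n - (l + a) mod n) mod n = (b + n - a) mod n"
proof -
  have "(l + a) mod n \<le> (l + b) mod n + n"
    using assms by (simp add: trans_le_add2)
  then have "int (((l + b) mod n + n - (l + a) mod n) mod n)
      = (int ((l + b) mod n) + int n - int ((l + a) mod n)) mod int n"
    by (simp only: zmod_int of_nat_diff of_nat_add)
  also have "\<dots> = (int (l + b) mod int n + int n - int (l + a) mod int n) mod int n"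
    by (simp only: zmod_int)
  also have "\<dots> = (int (l + b) mod int n + int n - int (l + a)) mod int n"
    by (rule mod_diff_right_eq)
  also have "\<dots> = (int (l + b) mod int n + (int n - int (l + a))) mod int n"
    by (simp only: add_diff_eq)
  also have "\<dots> = (int (l + b) + (int n - int (l + a))) mod int n"
    by (rule mod_add_left_eq)
  also have "int (l + b) + (int n - int (l + a)) = int (b + n - a)"
    using assms by simp
  also have "\<dots> mod int n = int ((b + n - a) mod n)"
    by (simp only: zmod_int)
  finally show ?thesis by simp
qed

text \<open>The differences within the pattern 0, 2, 3 are 1, 2, 3 and their negatives. For n \<ge>
  7 these are six distinct residues, so the difference of two points reveals their positions on the
  line, hence the line.\<close>

lemma line_through_two_points:
  assumes n: "n \<ge> 7" and inc: "incident n i l" "incident n j l" "i \<noteq> j"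
    and d: "d = (j + n - i) mod n"
  shows "l = (if d = 2 \<or> d = 3 then i else if d = 1 then (i + n - 2) mod n
    else if d = n - 1 then (j + n - 2) mod n else j)"
proof -
  have l: "l < n" using inc by (auto simp: incident_def)
  have ij: "i = (l + 0) mod n \<or> i = (l + 2) mod n \<or> i = (l + 3) mod n"
    "j = (l + 0) mod n \<or> j = (l + 2) mod n \<or> j = (l + 3) mod n"
    using inc by (auto simp: incident_def cyclic_line_def)
  have D: "d = (b + n - a) mod n" if "i = (l + a) mod n" "j = (l + b) mod n" "a < n" for a b
    unfolding d that(1,2) by (rule mod_diff_offset[OF that(3)])
  have l2: "((l + 2) mod n + n - 2) mod n = l" using shift_back[of 2 n l] n l by simp
  consider "i = (l + 0) mod n" "j = (l + 2) mod n" | "i = (l + 0) mod n" "j = (l + 3) mod n"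
    | "i = (l + 2) mod n" "j = (l + 0) mod n" | "i = (l + 2) mod n" "j = (l + 3) mod n"
    | "i = (l + 3) mod n" "j = (l + 0) mod n" | "i = (l + 3) mod n" "j = (l + 2) mod n"
    using ij inc(3) by auto
  then show ?thesis
  proof cases
    case 1
    then have "d = 2" "l = i" using D[of 0 2] n l by (simp_all add: mod_less_double)
    then show ?thesis by simp
  next
    case 2
    then have "d = 3" "l = i" using D[of 0 3] n l by (simp_all add: mod_less_double)
    then show ?thesis by simp
  next
    case 3
    then have "d = n - 2" "l = j" using D[of 2 0] n l by simp_all
    then show ?thesis using n by auto
  next
    case 4
    then have "d = 1" using D[of 2 3] n by (simp add: mod_less_double)
    then show ?thesis using 4 l2 by simp
  next
    case 5
    then have "d = n - 3" "l = j" using D[of 3 0] n l by simp_all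
    then show ?thesis using n by auto
  next
    case 6
    then have "d = n - 1" using D[of 3 2] n by simp
    then show ?thesis using 6 l2 n by auto
  qed
qed

lemma incident_linear:
  assumes "n \<ge> 7" "incident n i l" "incident n j l" "incident n i m" "incident n j m" "i \<noteq> j"
  shows "l = m"
  using line_through_two_points[OF assms(1,2,3,6) refl] line_through_two_points[OF assms(1,4,5,6) refl]
  by simp

lemma cyclic_line_inj:
  assumes n: "n \<ge> 7" "l < n" "m < n" and eq: "cyclic_line n l = cyclic_line n m"
  shows "l = m"
proof (rule incident_linear[OF n(1)])
  show "l \<noteq> (l + 2) mod n" using n by (auto simp: mod_less_double split: if_splits)
  show "incident n l l" "incident n ((l + 2) mod n) l" using n by (auto simp: incident_def cyclic_line_def)
  then show "incident n l m" "incident n ((l + 2) mod n) m" using n eq by (auto simp: incident_def)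
qed

text \<open>Extended periodically, a kernel vector satisfies a recurrence with characteristic
  polynomial x^3 + x + 1, a divisor of x^7 - 1 over F_2. It therefore has both periods 7 and n,
  which are coprime, so it is constant, and the recurrence reduces to c = c + c = 0.\<close>

lemma circulant_kernel:
  fixes n :: nat
  assumes n: "n \<ge> 7" "\<not> 7 dvd n"
    and e: "\<And>i. i < n \<Longrightarrow> e i + e ((i + n - 2) mod n) + e ((i + n - 3) mod n) = (0::bit)"
    and i: "i < n"
  shows "e i = 0"
proof -
  define E where "E k = e (k mod n)" for k
  have step: "E (k + 3) = E (k + 1) + E k" for k
  proof -
    have "((k + 3) mod n + n - 2) mod n = (k + 1) mod n" "((k + 3) mod n + n - 3) mod n = k mod n"
      using shift_back[of 2 n "k + 1"] shift_back[of 3 n k] n by (simp_all add: numeral_3_eq_3)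
    then show ?thesis using e[of "(k + 3) mod n"] n
      unfolding E_def by (simp add: bit_add_eq_iff add.assoc)
  qed
  have E7: "E (k + 7) = E k" for k
    using step[of k] step[of "k + 1"] step[of "k + 2"] step[of "k + 3"] step[of "k + 4"]
    by (simp add: bit_simps numeral_eq_Suc)
  have E7m: "E (k + 7 * m) = E k" for k m
  proof (induction m)
    case (Suc m)
    then show ?case using E7[of "k + 7 * m"] by (simp add: ac_simps)
  qed simp
  have Enm: "E (k + n * m) = E k" for k m
    by (simp add: E_def)
  \<comment> \<open>A shift by 7 * a = n * b + 1 fixes \<open>E\<close> as a multiple of 7 and acts
    as a shift by 1 modulo n.\<close>
  have "coprime 7 n" using n(2) by (intro prime_imp_coprime) simp_all
  then obtain a b where ab: "7 * a = n * b + 1"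
    using bezout_nat[of 7 n] by auto
  have "E (k + 1) = E k" for k
    using E7m[of k a] Enm[of "k + 1" b] ab by (simp add: ac_simps)
  then have "E i = 0" using step[of i] by (simp add: bit_add_self eval_nat_numeral)
  then show ?thesis using i by (simp add: E_def)
qed


text \<open>A trivial kernel makes the matrix injective, and an injective self-map of a finite set
  is onto. Extensional functions on \<open>{..<n}\<close> provide the finite set.\<close>

lemma circulant_solvable:
  fixes D :: "nat \<Rightarrow> bit"
  assumes n: "n \<ge> 7" "\<not> 7 dvd n"
  shows "\<exists>e. \<forall>i<n. (\<Sum>l | incident n i l. e l) = D i"
proof -
  let ?F = "{..<n} \<rightarrow>\<^sub>E (UNIV :: bit set)"
  define A where "A e = restrict (\<lambda>i. \<Sum>l | incident n i l. e l) {..<n}" for e :: "nat \<Rightarrow> bit"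
  have "(UNIV :: bit set) = {0, 1}" by auto
  then have "finite (UNIV :: bit set)" by (metis finite.emptyI finite.insertI)
  then have "finite ?F" by (intro finite_PiE) auto
  moreover have restrict: "restrict g {..<n} \<in> ?F" for g
    unfolding restrict_PiE_iff by blast
  then have "A ` ?F \<subseteq> ?F" unfolding A_def by blast
  moreover have "inj_on A ?F"
  proof (rule inj_onI)
    fix e e' assume e: "e \<in> ?F" "e' \<in> ?F" and eq: "A e = A e'"
    have sum_eq: "(\<Sum>l | incident n i l. e l) = (\<Sum>l | incident n i l. e' l)" if "i < n" for i
      using fun_cong[OF eq, of i] that by (simp add: A_def)
    have "(\<Sum>l | incident n i l. e l + e' l) = 0" if "i < n" for i
      using sum_eq[OF that] by (simp add: sum.distrib bit_add_self)
    then have "e i + e' i = 0" if "i < n" for i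
      using circulant_kernel[OF n _ that, of "\<lambda>l. e l + e' l"] sum_lines_through[OF n(1)] by simp
    then have "e i = e' i" if "i \<in> {..<n}" for i using that by (simp add: bit_add_eq_iff)
    then show "e = e'" by (rule PiE_ext[OF e])
  qed
  ultimately have "A ` ?F = ?F" by (rule endo_inj_surj)
  then have "restrict D {..<n} \<in> A ` ?F" using restrict by blast
  then obtain e where "restrict D {..<n} = A e" by blast
  then have "A e i = D i" if "i < n" for i
    using that by (metis lessThan_iff restrict_apply')
  then show ?thesis by (auto simp: A_def)
qed

text \<open>Every vector in the image is orthogonal to a left null vector. The null vector
  \<open>y\<close> grows from the seeds 0, 0, 1 and is well defined on residues modulo n because its
  period 7 divides n.\<close>

lemma circulant_not_solvable:
  assumes n: "n \<ge> 7" "7 dvd n"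
  shows "\<exists>D. \<nexists>e. \<forall>i<n. (\<Sum>l | incident n i l. e l) = (D i :: bit)"
proof -
  \<comment> \<open>a left null vector: the solution of y (l + 3) = y (l + 2) + y l, which has period 7\<close>
  define y :: "nat \<Rightarrow> bit" where "y i = (if i mod 7 \<in> {2, 3, 4, 6} then 1 else 0)" for i
  \<comment> \<open>The unit vector at 2, the first position where \<open>y\<close> is 1, has
    product 1 with \<open>y\<close> and so lies outside the image.\<close>
  define D :: "nat \<Rightarrow> bit" where "D i = (if i = 2 then 1 else 0)" for i
  have y_mod: "y (i mod n) = y i" for i
    using n(2) by (simp add: y_def mod_mod_cancel)
  have y_sum: "(\<Sum>i | incident n i l. y i) = 0" if "l < n" for l
  proof -
    have "l mod 7 < 7" by simp
    then have "l mod 7 \<in> {0, 1, 2, 3, 4, 5, 6}" by auto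
    moreover have "(l + 2) mod 7 = (l mod 7 + 2) mod 7" "(l + 3) mod 7 = (l mod 7 + 3) mod 7"
      by (simp_all only: mod_add_left_eq)
    ultimately have "y l + y (l + 2) + y (l + 3) = 0"
      unfolding y_def by (elim insertE emptyE) (simp_all add: bit_add_self)
    then show ?thesis by (simp only: sum_points_on_line[OF n(1) that] y_mod)
  qed
  have "False" if e: "\<forall>i<n. (\<Sum>l | incident n i l. e l) = D i" for e
  proof -
    have "1 = (\<Sum>i<n. y i * D i)"
    proof -
      have "(\<Sum>i<n. y i * D i) = (\<Sum>i<n. if i = 2 then y i else 0)"
        by (intro sum.cong) (auto simp: D_def)
      also have "\<dots> = y 2" using n(1) by simp
      finally show ?thesis by (simp add: y_def)
    qed
    also have "\<dots> = (\<Sum>i<n. \<Sum>l | l < n \<and> incident n i l. y i * e l)"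
    proof (intro sum.cong refl)
      fix i assume "i \<in> {..<n}"
      then have "D i = (\<Sum>l | incident n i l. e l)" using e by simp
      also have "{l. incident n i l} = {l. l < n \<and> incident n i l}" by (auto simp: incident_def)
      finally show "y i * D i = (\<Sum>l | l < n \<and> incident n i l. y i * e l)"
        by (simp only: sum_distrib_left)
    qed
    \<comment> \<open>Exchanging the sums moves the matrix from \<open>e\<close> to
      \<open>y\<close>, which it annihilates.\<close>
    also have "\<dots> = (\<Sum>l<n. \<Sum>i | i < n \<and> incident n i l. y i * e l)"
      using sum.swap_restrict[of "{..<n}" "{..<n}" "\<lambda>i l. y i * e l" "incident n"] by simp
    also have "\<dots> = 0"
    proof (rule sum.neutral, rule ballI)
      fix l assume "l \<in> {..<n}"
      then have "(\<Sum>i | incident n i l. y i) * e l = 0" using y_sum by simp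
      moreover have "{i. i < n \<and> incident n i l} = {i. incident n i l}" by (auto simp: incident_def)
      ultimately show "(\<Sum>i | i < n \<and> incident n i l. y i * e l) = 0"
        by (simp only: sum_distrib_right)
    qed
    finally show False by simp
  qed
  then show ?thesis by blast
qed

section \<open>Coordinates on the fibres\<close>

lemma perfect_matching_eq:
  assumes R: "perfect_matching {a, b, c, d} R" and dist: "distinct [a, b, c, d]" and ab: "(a, b) \<in> R"
  shows "R = {(a, b), (b, a), (c, d), (d, c)}"
proof -
  have sub: "R \<subseteq> {a, b, c, d} \<times> {a, b, c, d}" and irr: "\<And>x. (x, x) \<notin> R"
    and sy: "\<And>x y. (x, y) \<in> R \<Longrightarrow> (y, x) \<in> R"
    using R by (auto simp: perfect_matching_def irrefl_def dest: symD)
  have unique: "y = z" if "(x, y) \<in> R" "(x, z) \<in> R" for x y z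
    using that R sub unfolding perfect_matching_def by blast
  have ba: "(b, a) \<in> R" using sy ab .
  obtain z where z: "(c, z) \<in> R" using R unfolding perfect_matching_def by blast
  have "z \<noteq> c" using z irr by blast
  moreover have "z \<noteq> a" using z unique[OF ab, of c] sy dist by auto
  moreover have "z \<noteq> b" using z unique[OF ba, of c] sy dist by auto
  ultimately have cd: "(c, d) \<in> R" using z sub by blast
  have dc: "(d, c) \<in> R" using sy cd .
  have "(x, y) \<in> {(a, b), (b, a), (c, d), (d, c)}" if xy: "(x, y) \<in> R" for x y
  proof -
    have "x = a \<or> x = b \<or> x = c \<or> x = d" using sub xy by blast
    moreover have "x = a \<Longrightarrow> y = b" using unique[OF xy, of b] ab by simp
    moreover have "x = b \<Longrightarrow> y = a" using unique[OF xy, of a] ba by simp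
    moreover have "x = c \<Longrightarrow> y = d" using unique[OF xy, of d] cd by simp
    moreover have "x = d \<Longrightarrow> y = c" using unique[OF xy, of c] dc by simp
    ultimately show ?thesis by blast
  qed
  then have "R \<subseteq> {(a, b), (b, a), (c, d), (d, c)}" by (rule subrelI)
  moreover have "{(a, b), (b, a), (c, d), (d, c)} \<subseteq> R" using ab ba cd dc by simp
  ultimately show ?thesis by (rule equalityI)
qed

text \<open>An edge leaves two points, which have to be matched with each other.\<close>

lemma perfect_matching_unique:
  assumes A: "card A = 4" and RS: "perfect_matching A R" "perfect_matching A S"
    and ab: "(a, b) \<in> R" "(a, b) \<in> S"
  shows "R = S"
proof -
  have abA: "a \<in> A" "b \<in> A" "a \<noteq> b" using RS(1) ab(1) by (auto simp: perfect_matching_def irrefl_def)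
  have "finite A" using A by (metis card.infinite zero_neq_numeral)
  then have "card (A - {a, b}) = 2" using A abA by (simp add: card_Diff_subset)
  then obtain c d where cd: "A - {a, b} = {c, d}" "c \<noteq> d" by (meson card_2_iff)
  then have "A = {a, b, c, d}" using abA by blast
  moreover have "distinct [a, b, c, d]" using cd abA by auto
  ultimately show ?thesis using perfect_matching_eq RS ab by metis
qed

text \<open>Distinct matchings share no edge, so the three partners of \<open>x\<close> exhaust the
  remaining points, and each matching is determined by its edge at \<open>x\<close>.\<close>

lemma three_matchings:
  assumes A: "card A = 4" "x \<in> A"
    and M: "perfect_matching A R1" "perfect_matching A R2" "perfect_matching A R3"
    and dist: "R1 \<noteq> R2" "R1 \<noteq> R3" "R2 \<noteq> R3"
  obtains p q r where "A = {x, p, q, r}" "distinct [x, p, q, r]"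
    "R1 = {(x, p), (p, x), (q, r), (r, q)}" "R2 = {(x, q), (q, x), (p, r), (r, p)}"
    "R3 = {(x, r), (r, x), (p, q), (q, p)}"
proof -
  obtain p where p: "(x, p) \<in> R1" using M(1) A(2) unfolding perfect_matching_def by blast
  obtain q where q: "(x, q) \<in> R2" using M(2) A(2) unfolding perfect_matching_def by blast
  obtain r where r: "(x, r) \<in> R3" using M(3) A(2) unfolding perfect_matching_def by blast
  have ne: "p \<noteq> q" "p \<noteq> r" "q \<noteq> r"
    using perfect_matching_unique[OF A(1)] M dist p q r by blast+
  have pqr: "p \<in> A" "q \<in> A" "r \<in> A" "x \<noteq> p" "x \<noteq> q" "x \<noteq> r"
    using M p q r by (auto simp: perfect_matching_def irrefl_def)
  have d: "distinct [x, p, q, r]" using ne pqr by auto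
  have "finite A" using A by (metis card.infinite zero_neq_numeral)
  then have A': "{x, p, q, r} = A"
    using pqr A(2) d A(1) by (intro card_subset_eq) auto
  have "A = {x, q, p, r}" "A = {x, r, p, q}" using A' by blast+
  then show ?thesis
    using perfect_matching_eq[of x p q r R1] perfect_matching_eq[of x q p r R2]
      perfect_matching_eq[of x r p q R3] M A' d p q r that[of p q r] by auto
qed

section \<open>Coordinates read off from the matchings\<close>

locale cyclic_construction =
  fixes n :: nat and X :: "nat \<Rightarrow> 'a set" and M :: "nat \<Rightarrow> nat set \<Rightarrow> ('a \<times> 'a) set"
  assumes n7: "n \<ge> 7" and choices: "cyclic_choices n X M"
begin

definition fibre :: "'a \<Rightarrow> nat" where
  "fibre x = (THE i. i < n \<and> x \<in> X i)"

definition base :: "nat \<Rightarrow> 'a" where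
  "base i = (SOME x. x \<in> X i)"

text \<open>The matching of a line through the fibre has two edges; the one at the base point gets
  0, the other 1. Another base point would only translate the fibre by a vector of sum 0.\<close>

definition coord :: "nat \<Rightarrow> 'a \<Rightarrow> bit" where
  "coord l x = (if x = base (fibre x) \<or> (base (fibre x), x) \<in> M (fibre x) (cyclic_line n l) then 0 else 1)"

lemma card_X: "i < n \<Longrightarrow> card (X i) = 4"
  using choices by (simp add: cyclic_choices_def)

lemma fibre_eq: "i < n \<Longrightarrow> x \<in> X i \<Longrightarrow> fibre x = i"
  using choices unfolding fibre_def cyclic_choices_def disjoint_family_on_def
  by (intro the_equality) auto

lemma points_iff: "x \<in> cyclic_points n X \<longleftrightarrow> fibre x < n \<and> x \<in> X (fibre x)"
  using fibre_eq by (auto simp: cyclic_points_def)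

lemma fibre_pointsI:
  assumes "i < n" "u \<in> X i"
  shows "u \<in> cyclic_points n X" "fibre u = i"
  using fibre_eq[OF assms] assms by (simp_all add: points_iff)

lemma base_in:
  assumes "i < n"
  shows "base i \<in> X i"
proof -
  have "X i \<noteq> {}" using card_X[OF assms] by auto
  then show ?thesis by (simp add: base_def some_in_eq)
qed

lemma matching: "incident n i l \<Longrightarrow> perfect_matching (X i) (M i (cyclic_line n l))"
  using choices by (auto simp: cyclic_choices_def incident_def cyclic_lines_def cyclic_line_def)

lemma matching_inj:
  assumes "incident n i l" "incident n i m" "l \<noteq> m"
  shows "M i (cyclic_line n l) \<noteq> M i (cyclic_line n m)"
proof -
  have "cyclic_line n l \<noteq> cyclic_line n m"
    using assms cyclic_line_inj[OF n7] by (auto simp: incident_def)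
  moreover have "inj_on (M i) {L \<in> cyclic_lines n. i \<in> L}"
    "cyclic_line n l \<in> {L \<in> cyclic_lines n. i \<in> L}" "cyclic_line n m \<in> {L \<in> cyclic_lines n. i \<in> L}"
    using assms choices by (auto simp: cyclic_choices_def incident_def cyclic_lines_def cyclic_line_def)
  ultimately show ?thesis by (meson inj_on_eq_iff)
qed

text \<open>The point p is the base point, and the table lists the even vectors 000, 011, 101, 110
  for p, q, r, s. The assumptions of \<open>affine_configuration\<close> on coordinates are read off
  from it.\<close>

lemma fibre_coordinates:
  assumes i: "i < n"
  obtains l1 l2 l3 p q r s where "{l. incident n i l} = {l1, l2, l3}" "distinct [l1, l2, l3]"
    "X i = {p, q, r, s}" "distinct [p, q, r, s]"
    "M i (cyclic_line n l1) = {(p, q), (q, p), (r, s), (s, r)}"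
    "M i (cyclic_line n l2) = {(p, r), (r, p), (q, s), (s, q)}"
    "M i (cyclic_line n l3) = {(p, s), (s, p), (q, r), (r, q)}"
    "coord l1 p = 0" "coord l1 q = 0" "coord l1 r = 1" "coord l1 s = 1"
    "coord l2 p = 0" "coord l2 q = 1" "coord l2 r = 0" "coord l2 s = 1"
    "coord l3 p = 0" "coord l3 q = 1" "coord l3 r = 1" "coord l3 s = 0"
proof -
  obtain l1 l2 l3 where l: "{l. incident n i l} = {l1, l2, l3}" "l1 \<noteq> l2" "l1 \<noteq> l3" "l2 \<noteq> l3"
    using card_lines_through[OF n7 i] by (auto simp: card_3_iff)
  then have inc: "incident n i l1" "incident n i l2" "incident n i l3" by auto
  obtain q r s where qrs: "X i = {base i, q, r, s}" "distinct [base i, q, r, s]"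
    "M i (cyclic_line n l1) = {(base i, q), (q, base i), (r, s), (s, r)}"
    "M i (cyclic_line n l2) = {(base i, r), (r, base i), (q, s), (s, q)}"
    "M i (cyclic_line n l3) = {(base i, s), (s, base i), (q, r), (r, q)}"
    by (rule three_matchings[OF card_X[OF i] base_in[OF i] inc[THEN matching]
      matching_inj[OF inc(1,2) l(2)] matching_inj[OF inc(1,3) l(3)] matching_inj[OF inc(2,3) l(4)]])
  have fib: "fibre x = i" if "x \<in> {base i, q, r, s}" for x
    using fibre_eq[OF i] that qrs(1) by blast
  have c: "coord l x = (if x = base i \<or> (base i, x) \<in> M i (cyclic_line n l) then 0 else 1)"
    if "x \<in> {base i, q, r, s}" for l x
    using fib[OF that] by (simp add: coord_def)
  show ?thesis
    by (rule that[of l1 l2 l3 "base i" q r s]) (use l qrs in \<open>auto simp: c\<close>)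
qed

lemma matching_iff_coord:
  assumes "incident n i l"
  shows "(x, y) \<in> M i (cyclic_line n l) \<longleftrightarrow> x \<in> X i \<and> y \<in> X i \<and> x \<noteq> y \<and> coord l x = coord l y"
proof -
  have i: "i < n" using assms by (simp add: incident_def)
  obtain l1 l2 l3 p q r s where *: "{l. incident n i l} = {l1, l2, l3}"
    "X i = {p, q, r, s}" "distinct [p, q, r, s]"
    "M i (cyclic_line n l1) = {(p, q), (q, p), (r, s), (s, r)}"
    "M i (cyclic_line n l2) = {(p, r), (r, p), (q, s), (s, q)}"
    "M i (cyclic_line n l3) = {(p, s), (s, p), (q, r), (r, q)}"
    "coord l1 p = 0" "coord l1 q = 0" "coord l1 r = 1" "coord l1 s = 1"
    "coord l2 p = 0" "coord l2 q = 1" "coord l2 r = 0" "coord l2 s = 1"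
    "coord l3 p = 0" "coord l3 q = 1" "coord l3 r = 1" "coord l3 s = 0"
    by (rule fibre_coordinates[OF i])
  consider "l = l1" | "l = l2" | "l = l3" using *(1) assms by blast
  then show ?thesis
  proof cases
    case 1
    show ?thesis unfolding 1 *(2) *(4) using *(3) *(7-10) by auto
  next
    case 2
    show ?thesis unfolding 2 *(2) *(5) using *(3) *(11-14) by auto
  next
    case 3
    show ?thesis unfolding 3 *(2) *(6) using *(3) *(15-18) by auto
  qed
qed

lemma matching_labels:
  assumes "incident n i l"
  obtains a1 a2 a3 a4 where "M i (cyclic_line n l) = {(a1, a2), (a2, a1), (a3, a4), (a4, a3)}"
proof -
  have i: "i < n" using assms by (simp add: incident_def)
  obtain l1 l2 l3 p q r s where *: "{l. incident n i l} = {l1, l2, l3}"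
    "M i (cyclic_line n l1) = {(p, q), (q, p), (r, s), (s, r)}"
    "M i (cyclic_line n l2) = {(p, r), (r, p), (q, s), (s, q)}"
    "M i (cyclic_line n l3) = {(p, s), (s, p), (q, r), (r, q)}"
    by (rule fibre_coordinates[OF i])
  consider "l = l1" | "l = l2" | "l = l3" using *(1) assms by blast
  then show ?thesis using that *(2-4) by cases blast+
qed

text \<open>The labels come from an arbitrary way of writing the matching, so their distinctness is
  recovered from the four points of the fibre.\<close>

lemma coord_labels:
  assumes l: "incident n i l"
    and eq: "M i (cyclic_line n l) = {(a1, a2), (a2, a1), (a3, a4), (a4, a3)}"
  shows "X i = {a1, a2, a3, a4}" "coord l a2 = coord l a1" "coord l a4 = coord l a3" "coord l a3 \<noteq> coord l a1"
proof -
  have i: "i < n" using l by (simp add: incident_def)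
  have pm: "perfect_matching (X i) (M i (cyclic_line n l))" using matching l .
  then have "\<exists>b. (a, b) \<in> M i (cyclic_line n l)" if "a \<in> X i" for a
    using that unfolding perfect_matching_def by blast
  moreover have "M i (cyclic_line n l) \<subseteq> X i \<times> X i" using pm by (simp add: perfect_matching_def)
  ultimately show X: "X i = {a1, a2, a3, a4}" unfolding eq by blast
  then have d: "distinct [a1, a2, a3, a4]"
    using card_X[OF i] by (intro card_distinct) simp
  show "coord l a2 = coord l a1" "coord l a4 = coord l a3"
    using matching_iff_coord[OF l, of a1 a2] matching_iff_coord[OF l, of a3 a4] eq by simp_all
  have "(a1, a3) \<notin> M i (cyclic_line n l)" unfolding eq using d by auto
  then show "coord l a3 \<noteq> coord l a1"
    using matching_iff_coord[OF l, of a1 a3] X d by auto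
qed

sublocale affine_configuration "{..<n}" "incident n" "cyclic_points n X" fibre coord
proof
  show "finite (cyclic_points n X)"
    using card_X unfolding cyclic_points_def by (intro finite_UN_I) (auto intro: card_ge_0_finite)
  show "fibre x \<in> {..<n}" if "x \<in> cyclic_points n X" for x using that by (simp add: points_iff)
  show "card {l. incident n i l} = 3" if "i \<in> {..<n}" for i
    using card_lines_through[OF n7] that by simp
  show "l = m" if "incident n i l" "incident n j l" "incident n i m" "incident n j m" "i \<noteq> j" for i j l m
    using incident_linear[OF n7] that by blast
next
  fix x assume "x \<in> cyclic_points n X"
  then have x: "fibre x < n" "x \<in> X (fibre x)" by (simp_all add: points_iff)
  obtain l1 l2 l3 p q r s where *: "{l. incident n (fibre x) l} = {l1, l2, l3}" "distinct [l1, l2, l3]"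
    "X (fibre x) = {p, q, r, s}"
    "coord l1 p = 0" "coord l1 q = 0" "coord l1 r = 1" "coord l1 s = 1"
    "coord l2 p = 0" "coord l2 q = 1" "coord l2 r = 0" "coord l2 s = 1"
    "coord l3 p = 0" "coord l3 q = 1" "coord l3 r = 1" "coord l3 s = 0"
    by (rule fibre_coordinates[OF x(1)])
  have "x = p \<or> x = q \<or> x = r \<or> x = s" using x(2) *(3) by simp
  then show "(\<Sum>l | incident n (fibre x) l. coord l x) = 0"
    unfolding *(1) using *(2) *(4-15) by (elim disjE) simp_all
next
  fix i and t :: "nat \<Rightarrow> bit" assume i: "i \<in> {..<n}" and t: "(\<Sum>l | incident n i l. t l) = 0"
  have i': "i < n" using i by simp
  obtain l1 l2 l3 p q r s where *: "{l. incident n i l} = {l1, l2, l3}" "distinct [l1, l2, l3]"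
    "X i = {p, q, r, s}"
    "coord l1 p = 0" "coord l1 q = 0" "coord l1 r = 1" "coord l1 s = 1"
    "coord l2 p = 0" "coord l2 q = 1" "coord l2 r = 0" "coord l2 s = 1"
    "coord l3 p = 0" "coord l3 q = 1" "coord l3 r = 1" "coord l3 s = 0"
    by (rule fibre_coordinates[OF i'])
  have "t l1 + t l2 + t l3 = 0" using t *(2) unfolding *(1) by (simp add: add.assoc)
  then have t3: "t l3 = t l1 + t l2" unfolding bit_add_eq_iff by simp
  have "\<exists>x\<in>X i. coord l1 x = t l1 \<and> coord l2 x = t l2 \<and> coord l3 x = t l3"
    unfolding t3 *(3) by (cases "t l1"; cases "t l2") (simp_all add: *(4-15))
  then obtain x where x: "x \<in> X i" "coord l1 x = t l1" "coord l2 x = t l2" "coord l3 x = t l3" by blast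
  have "coord l x = t l" if "incident n i l" for l
  proof -
    have "l \<in> {l1, l2, l3}" using that *(1) by blast
    then show ?thesis using x by auto
  qed
  then show "\<exists>x\<in>cyclic_points n X. fibre x = i \<and> (\<forall>l. incident n i l \<longrightarrow> coord l x = t l)"
    using x(1) fibre_eq[OF i' x(1)] i' by (intro bexI[of _ x]) (simp_all add: points_iff)
next
  fix x y assume xy: "x \<in> cyclic_points n X" "y \<in> cyclic_points n X" "fibre x = fibre y"
    and eq: "\<And>l. incident n (fibre x) l \<Longrightarrow> coord l x = coord l y"
  then have x: "fibre x < n" "x \<in> X (fibre x)" "y \<in> X (fibre x)" by (simp_all add: points_iff)
  obtain l1 l2 l3 p q r s where *: "{l. incident n (fibre x) l} = {l1, l2, l3}"
    "X (fibre x) = {p, q, r, s}"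
    "coord l1 p = 0" "coord l1 q = 0" "coord l1 r = 1" "coord l1 s = 1"
    "coord l2 p = 0" "coord l2 q = 1" "coord l2 r = 0" "coord l2 s = 1"
    by (rule fibre_coordinates[OF x(1)])
  have eqs: "coord l1 x = coord l1 y" "coord l2 x = coord l2 y" using *(1) by (auto intro: eq)
  have "x = p \<or> x = q \<or> x = r \<or> x = s" "y = p \<or> y = q \<or> y = r \<or> y = s" using x(2,3) *(2) by simp_all
  then show "x = y" using eqs *(3-10) by (elim disjE) simp_all
qed

text \<open>For two fibres on the line l, the bits c = 0 and c = 1 give the two relations into which
  the product is split.\<close>

definition level :: "nat \<Rightarrow> nat \<Rightarrow> nat \<Rightarrow> bit \<Rightarrow> ('a \<times> 'a) set" where
  "level l i j c = {(x, y). x \<in> X i \<and> y \<in> X j \<and> coord l x + coord l y = c}"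

lemma level_compl: "X i \<times> X j - level l i j c = level l i j (c + 1)"
proof -
  have "a \<noteq> c \<longleftrightarrow> a = c + 1" for a :: bit
    by (cases a; cases c) auto
  then show ?thesis unfolding level_def by auto
qed

text \<open>The two edges of each matching are the level sets of its coordinate. The union contains
  a pair exactly when both of its coordinates agree with those of (a1, b1) or both differ, which
  over F_2 means that the sums agree.\<close>

lemma level_labels:
  assumes "incident n i l" "incident n j l"
    and "M i (cyclic_line n l) = {(a1, a2), (a2, a1), (a3, a4), (a4, a3)}"
    and "M j (cyclic_line n l) = {(b1, b2), (b2, b1), (b3, b4), (b4, b3)}"
  shows "{a1, a2} \<times> {b1, b2} \<union> {a3, a4} \<times> {b3, b4} = level l i j (coord l a1 + coord l b1)"
proof -
  note a = coord_labels[OF assms(1,3)] and b = coord_labels[OF assms(2,4)]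
  have "{a1, a2} = {x \<in> X i. coord l x = coord l a1}" "{a3, a4} = {x \<in> X i. coord l x \<noteq> coord l a1}"
    unfolding a(1) using a(2-4) by auto
  moreover have "{b1, b2} = {x \<in> X j. coord l x = coord l b1}" "{b3, b4} = {x \<in> X j. coord l x \<noteq> coord l b1}"
    unfolding b(1) using b(2-4) by auto
  moreover have "c + d = c' + d' \<longleftrightarrow> (c = c' \<longleftrightarrow> d = d')" for c d c' d' :: bit
    by (cases c; cases d; cases c'; cases d') simp_all
  ultimately show ?thesis unfolding level_def by auto
qed

lemma split_relations_eq:
  assumes "incident n i l" "incident n j l"
  shows "split_relations (X i) (X j) (M i (cyclic_line n l)) (M j (cyclic_line n l)) = range (level l i j)"
proof
  show "split_relations (X i) (X j) (M i (cyclic_line n l)) (M j (cyclic_line n l)) \<subseteq> range (level l i j)"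
  proof
    fix R assume "R \<in> split_relations (X i) (X j) (M i (cyclic_line n l)) (M j (cyclic_line n l))"
    then obtain a1 a2 a3 a4 b1 b2 b3 b4 P where
      *: "M i (cyclic_line n l) = {(a1, a2), (a2, a1), (a3, a4), (a4, a3)}"
        "M j (cyclic_line n l) = {(b1, b2), (b2, b1), (b3, b4), (b4, b3)}"
      and P: "P = {a1, a2} \<times> {b1, b2} \<union> {a3, a4} \<times> {b3, b4}" "R = P \<or> R = X i \<times> X j - P"
      unfolding split_relations_def mem_Collect_eq by blast
    have "P = level l i j (coord l a1 + coord l b1)"
      unfolding P(1) by (rule level_labels[OF assms *])
    then show "R \<in> range (level l i j)" using P(2) level_compl by auto
  qed
  obtain a1 a2 a3 a4 where a: "M i (cyclic_line n l) = {(a1, a2), (a2, a1), (a3, a4), (a4, a3)}"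
    by (rule matching_labels[OF assms(1)])
  obtain b1 b2 b3 b4 where b: "M j (cyclic_line n l) = {(b1, b2), (b2, b1), (b3, b4), (b4, b3)}"
    by (rule matching_labels[OF assms(2)])
  let ?c = "coord l a1 + coord l b1"
  \<comment> \<open>With only two bits available, each level is the one obtained from the labels or
    its complement.\<close>
  have "c = ?c \<or> c = ?c + 1" for c
    by (cases c; cases ?c) auto
  then have "level l i j c = level l i j ?c \<or> level l i j c = X i \<times> X j - level l i j ?c" for c
    unfolding level_compl by metis
  then show "range (level l i j) \<subseteq> split_relations (X i) (X j) (M i (cyclic_line n l)) (M j (cyclic_line n l))"
    unfolding split_relations_def level_labels[OF assms a b, symmetric] using a b by blast
qed

lemma level_nonempty:
  assumes "incident n i l" "incident n j l"
  obtains u v where "(u, v) \<in> level l i j c"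
proof -
  obtain a1 a2 a3 a4 where a: "M i (cyclic_line n l) = {(a1, a2), (a2, a1), (a3, a4), (a4, a3)}"
    by (rule matching_labels[OF assms(1)])
  have j: "j < n" using assms(2) by (simp add: incident_def)
  have "c = coord l a1 + coord l (base j) \<or> c = coord l a3 + coord l (base j)"
    using coord_labels(4)[OF assms(1) a]
    by (cases c; cases "coord l a1"; cases "coord l a3"; cases "coord l (base j)") auto
  then have "(a1, base j) \<in> level l i j c \<or> (a3, base j) \<in> level l i j c"
    using base_in[OF j] coord_labels(1)[OF assms(1) a] by (auto simp: level_def)
  then show ?thesis using that by blast
qed

section \<open>Identification of the colour classes with the basis relations\<close>

lemma color_fibre: "color x y = color u v \<Longrightarrow> fibre x = fibre u \<and> fibre y = fibre v"
  by (simp add: color_def)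

lemma color_class_loop:
  assumes "u \<in> cyclic_points n X"
  shows "color_class (color u u) = Id_on (X (fibre u))"
proof -
  have "(x, y) \<in> color_class (color u u) \<longleftrightarrow> (x, y) \<in> Id_on (X (fibre u))" for x y
  proof
    assume "(x, y) \<in> color_class (color u u)"
    then have *: "x \<in> cyclic_points n X" "y \<in> cyclic_points n X" "color x y = color u u" by simp_all
    have "x = y" using * by (rule color_self_eqD)
    moreover have "fibre x = fibre u" using color_fibre[OF *(3)] by simp
    moreover have "x \<in> X (fibre x)" using *(1) by (simp add: points_iff)
    ultimately show "(x, y) \<in> Id_on (X (fibre u))" by auto
  next
    assume "(x, y) \<in> Id_on (X (fibre u))"
    then have x: "y = x" "x \<in> X (fibre u)" by auto
    have u: "fibre u < n" using assms by (simp add: points_iff)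
    have "fibre x = fibre u" using fibre_eq[OF u x(2)] .
    moreover from this have "color x x = color u u" by (simp add: color_eq_color_iff bit_add_self)
    ultimately show "(x, y) \<in> color_class (color u u)"
      using x u by (simp add: points_iff)
  qed
  then show ?thesis by (intro equalityI subrelI) blast+
qed

text \<open>The colour of two distinct points of a fibre is a nonzero vector of sum 0, and its class
  is the graph of the translation by this vector, an involution without fixed points.\<close>

lemma color_class_matching:
  assumes u: "u \<in> cyclic_points n X" and v: "v \<in> cyclic_points n X" and uv: "fibre u = fibre v" "u \<noteq> v"
  shows "perfect_matching (X (fibre u)) (color_class (color u v))"
  unfolding perfect_matching_def
proof (intro conjI ballI)
  show "color_class (color u v) \<subseteq> X (fibre u) \<times> X (fibre u)"
  proof (rule subrelI)
    fix x y assume "(x, y) \<in> color_class (color u v)"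
    then have *: "x \<in> cyclic_points n X" "y \<in> cyclic_points n X" "color x y = color u v" by simp_all
    then show "(x, y) \<in> X (fibre u) \<times> X (fibre u)"
      using color_fibre[OF *(3)] uv(1) by (simp add: points_iff)
  qed
  show "sym (color_class (color u v))"
  proof (rule symI)
    fix x y assume "(x, y) \<in> color_class (color u v)"
    then have *: "x \<in> cyclic_points n X" "y \<in> cyclic_points n X" "color x y = color u v" by simp_all
    have "color v u = color u v" using uv(1) by (simp add: color_eq_color_iff add.commute)
    moreover have "color y x = color v u" using *(3) by (simp only: color_swap[of y x v u])
    ultimately show "(y, x) \<in> color_class (color u v)" using * by simp
  qed
  show "irrefl (color_class (color u v))"
  proof (rule irreflI)
    fix x
    have "color u v \<noteq> color x x" using color_self_eqD[OF u v] uv(2) by blast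
    then show "(x, x) \<notin> color_class (color u v)" by simp
  qed
  fix a assume a: "a \<in> X (fibre u)"
  have a': "a \<in> cyclic_points n X" "fibre a = fibre u"
    using fibre_pointsI[OF _ a] u by (simp_all add: points_iff)
  have "(\<Sum>l | incident n (fibre a) l. coord l u + coord l v) = 0"
    using h_sum[OF u] h_sum[OF v] uv a' by (simp add: sum.distrib)
  from translation[OF a'(1) this] obtain b where b: "b \<in> cyclic_points n X" "fibre b = fibre a"
    "\<And>l. incident n (fibre a) l \<Longrightarrow> coord l b = coord l a + (coord l u + coord l v)" by blast
  show "\<exists>!b. (a, b) \<in> color_class (color u v)"
  proof (rule ex1I[of _ b])
    show "(a, b) \<in> color_class (color u v)"
      using a' b uv by (simp add: color_eq_color_iff bit_simps)
    fix y assume "(a, y) \<in> color_class (color u v)"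
    then have y: "y \<in> cyclic_points n X" "color a y = color u v" by simp_all
    show "y = b"
    proof (rule point_eq[OF y(1) b(1)])
      show fib: "fibre y = fibre b" using y(2) b(2) a' uv by (simp add: color_eq_color_iff)
      fix l assume "incident n (fibre y) l"
      then have l: "incident n (fibre a) l" using fib b by simp
      have eq: "coord l a + coord l y = coord l u + coord l v"
        using y(2) l a' uv by (simp add: color_eq_color_iff)
      show "coord l y = coord l b" unfolding b(3)[OF l] eq[symmetric] by (simp only: bit_add_left_self)
    qed
  qed
qed

text \<open>By linearity l is the only line through both fibres, so the colour carries a single
  bit.\<close>

lemma color_class_level:
  assumes u: "u \<in> cyclic_points n X" and v: "v \<in> cyclic_points n X" and ne: "fibre u \<noteq> fibre v"
    and l: "incident n (fibre u) l" "incident n (fibre v) l"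
  shows "color_class (color u v) = level l (fibre u) (fibre v) (coord l u + coord l v)"
proof -
  have unique: "m = l" if "incident n (fibre u) m" "incident n (fibre v) m" for m
    using linear that l ne by metis
  have "(x, y) \<in> color_class (color u v) \<longleftrightarrow> (x, y) \<in> level l (fibre u) (fibre v) (coord l u + coord l v)" for x y
  proof
    assume "(x, y) \<in> color_class (color u v)"
    then have *: "x \<in> cyclic_points n X" "y \<in> cyclic_points n X" "color x y = color u v" by simp_all
    have fib: "fibre x = fibre u" "fibre y = fibre v" using color_fibre[OF *(3)] by simp_all
    then have "coord l x + coord l y = coord l u + coord l v"
      using *(3) l unfolding color_eq_color_iff by metis
    then show "(x, y) \<in> level l (fibre u) (fibre v) (coord l u + coord l v)"
      using *(1,2) fib by (simp add: level_def points_iff)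
  next
    assume xy: "(x, y) \<in> level l (fibre u) (fibre v) (coord l u + coord l v)"
    then have "x \<in> X (fibre u)" "y \<in> X (fibre v)" by (simp_all add: level_def)
    then have fib: "fibre x = fibre u" "fibre y = fibre v"
      using u v fibre_pointsI(2) by (simp_all add: points_iff)
    have "color x y = color u v"
      unfolding color_eq_color_iff fib
    proof (intro conjI refl allI impI)
      fix m assume "incident n (fibre u) m" "incident n (fibre v) m"
      then have "m = l" by (rule unique)
      then show "coord m x + coord m y = coord m u + coord m v" using xy by (simp add: level_def)
    qed
    then show "(x, y) \<in> color_class (color u v)"
      using u v xy fib by (simp add: points_iff level_def)
  qed
  then show ?thesis by (intro equalityI subrelI) blast+
qed

lemma color_class_full:
  assumes u: "u \<in> cyclic_points n X" and v: "v \<in> cyclic_points n X"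
    and none: "\<And>l. \<not> (incident n (fibre u) l \<and> incident n (fibre v) l)"
  shows "color_class (color u v) = X (fibre u) \<times> X (fibre v)"
proof -
  have uv: "fibre u < n" "fibre v < n" using u v by (simp_all add: points_iff)
  have "(x, y) \<in> color_class (color u v) \<longleftrightarrow> (x, y) \<in> X (fibre u) \<times> X (fibre v)" for x y
  proof
    assume "(x, y) \<in> color_class (color u v)"
    then have *: "x \<in> cyclic_points n X" "y \<in> cyclic_points n X" "color x y = color u v" by simp_all
    then show "(x, y) \<in> X (fibre u) \<times> X (fibre v)"
      using color_fibre[OF *(3)] by (simp add: points_iff)
  next
    assume "(x, y) \<in> X (fibre u) \<times> X (fibre v)"
    then have xy: "x \<in> X (fibre u)" "y \<in> X (fibre v)" by simp_all
    note x = fibre_pointsI[OF uv(1) xy(1)] and y = fibre_pointsI[OF uv(2) xy(2)]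
    have "color x y = color u v"
      unfolding color_eq_color_iff x(2) y(2) using none by blast
    then show "(x, y) \<in> color_class (color u v)" using x y by simp
  qed
  then show ?thesis by (intro equalityI subrelI) blast+
qed

lemma collinear_iff:
  "(\<exists>L\<in>cyclic_lines n. i \<in> L \<and> j \<in> L) \<longleftrightarrow> (\<exists>l. incident n i l \<and> incident n j l)"
  using n7 by (auto simp: cyclic_lines_def incident_def cyclic_line_def)

lemma cyclic_lines_incident:
  assumes "L \<in> cyclic_lines n" "i \<in> L"
  obtains l where "L = cyclic_line n l" "incident n i l" "\<And>j. j \<in> L \<longleftrightarrow> incident n j l"
proof -
  obtain l where l: "l < n" "L = cyclic_line n l"
    using assms(1) by (auto simp: cyclic_lines_def cyclic_line_def)
  have "j \<in> L \<longleftrightarrow> incident n j l" for j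
    using l n7 by (auto simp: incident_def cyclic_line_def)
  then show ?thesis using that l assms(2) by blast
qed

lemma incident_cyclic_lines:
  "incident n i l \<Longrightarrow> cyclic_line n l \<in> cyclic_lines n \<and> i \<in> cyclic_line n l"
  by (auto simp: incident_def cyclic_lines_def cyclic_line_def)

lemma classes_eq: "classes = cyclic_configuration n X M"
proof
  show "classes \<subseteq> cyclic_configuration n X M"
  proof
    fix R assume "R \<in> classes"
    then obtain u v where u: "u \<in> cyclic_points n X" and v: "v \<in> cyclic_points n X"
      and R: "R = color_class (color u v)" by (rule classesE)
    have uv: "fibre u < n" "fibre v < n" using u v by (simp_all add: points_iff)
    consider "u = v" | "fibre u = fibre v" "u \<noteq> v"
      | l where "fibre u \<noteq> fibre v" "incident n (fibre u) l" "incident n (fibre v) l"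
      | "fibre u \<noteq> fibre v" "\<nexists>l. incident n (fibre u) l \<and> incident n (fibre v) l" by blast
    then show "R \<in> cyclic_configuration n X M"
    proof cases
      case 1
      then have "R = Id_on (X (fibre u))" using color_class_loop[OF u] R by simp
      then show ?thesis using uv unfolding cyclic_configuration_def by blast
    next
      case 2
      then have "perfect_matching (X (fibre u)) R" using color_class_matching[OF u v] R by simp
      then show ?thesis using uv unfolding cyclic_configuration_def by blast
    next
      case 3
      then have "R \<in> range (level l (fibre u) (fibre v))" using color_class_level[OF u v 3] R by simp
      then have "R \<in> split_relations (X (fibre u)) (X (fibre v))
          (M (fibre u) (cyclic_line n l)) (M (fibre v) (cyclic_line n l))"
        using split_relations_eq[OF 3(2,3)] by simp
      then show ?thesis
        using incident_cyclic_lines[OF 3(2)] incident_cyclic_lines[OF 3(3)] 3(1)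
        unfolding cyclic_configuration_def
        by (intro UnI1 UnI2 UN_I[of "cyclic_line n l"] UN_I[of "fibre u"] UN_I[of "fibre v"]) auto
    next
      case 4
      then have "R = X (fibre u) \<times> X (fibre v)" using color_class_full[OF u v] R by blast
      moreover have "\<not> (\<exists>L\<in>cyclic_lines n. fibre u \<in> L \<and> fibre v \<in> L)"
        using 4(2) collinear_iff by simp
      ultimately have "R \<in> {X i \<times> X j | i j. i < n \<and> j < n \<and> i \<noteq> j \<and>
          \<not> (\<exists>L\<in>cyclic_lines n. i \<in> L \<and> j \<in> L)}"
        using uv 4(1) by blast
      then show ?thesis unfolding cyclic_configuration_def by (rule UnI2)
    qed
  qed
  show "cyclic_configuration n X M \<subseteq> classes"
    unfolding cyclic_configuration_def
  proof (intro Un_least UN_least)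
    fix i assume "i \<in> {..<n}"
    then have i: "i < n" by simp
    note b = fibre_pointsI[OF i base_in[OF i]]
    show "insert (Id_on (X i)) {R. perfect_matching (X i) R} \<subseteq> classes"
    proof (intro insert_subsetI subsetI)
      show "Id_on (X i) \<in> classes"
        using color_class_loop[OF b(1)] color_class_in[OF b(1) b(1)] b(2) by simp
      fix R assume "R \<in> {R. perfect_matching (X i) R}"
      then have R: "perfect_matching (X i) R" by simp
      then obtain v where v: "(base i, v) \<in> R"
        using base_in[OF i] unfolding perfect_matching_def by blast
      have "R \<subseteq> X i \<times> X i" "irrefl R" using R by (simp_all add: perfect_matching_def)
      then have v': "v \<in> X i" "base i \<noteq> v" using v by (auto simp: irrefl_def)
      note p = fibre_pointsI[OF i v'(1)]
      have "perfect_matching (X i) (color_class (color (base i) v))"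
        using color_class_matching[OF b(1) p(1) _ v'(2)] b(2) p(2) by simp
      \<comment> \<open>Both matchings contain the edge at the base point, which determines
        them.\<close>
      then have "R = color_class (color (base i) v)"
        using v b p by (intro perfect_matching_unique[OF card_X[OF i] R]) simp_all
      then show "R \<in> classes" using color_class_in[OF b(1) p(1)] by simp
    qed
  next
    fix L i j assume L: "L \<in> cyclic_lines n" "i \<in> L" and j: "j \<in> L - {i}"
    obtain l where l: "L = cyclic_line n l" "incident n i l" "incident n j l"
      using cyclic_lines_incident[OF L] j by blast
    have ij: "i < n" "j < n" using l by (simp_all add: incident_def)
    have "level l i j c \<in> classes" for c
    proof -
      obtain u v where uv: "(u, v) \<in> level l i j c" using level_nonempty[OF l(2,3)] by blast
      have X: "u \<in> X i" "v \<in> X j" and c: "coord l u + coord l v = c" using uv by (simp_all add: level_def)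
      note p = fibre_pointsI[OF ij(1) X(1)] and q = fibre_pointsI[OF ij(2) X(2)]
      have "color_class (color u v) = level l i j c"
        using color_class_level[OF p(1) q(1), of l] p(2) q(2) l(2,3) j c by simp
      then show ?thesis using color_class_in[OF p(1) q(1)] by simp
    qed
    then show "split_relations (X i) (X j) (M i L) (M j L) \<subseteq> classes"
      unfolding l(1) split_relations_eq[OF l(2,3)] by blast
  next
    have "X i \<times> X j \<in> classes"
      if ij: "i < n" "j < n" and none: "\<not> (\<exists>L\<in>cyclic_lines n. i \<in> L \<and> j \<in> L)" for i j
    proof -
      note p = fibre_pointsI[OF ij(1) base_in[OF ij(1)]] and q = fibre_pointsI[OF ij(2) base_in[OF ij(2)]]
      have "color_class (color (base i) (base j)) = X i \<times> X j"
        using color_class_full[OF p(1) q(1)] p(2) q(2) none unfolding collinear_iff by simp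
      then show ?thesis using color_class_in[OF p(1) q(1)] by simp
    qed
    then show "{X i \<times> X j | i j. i < n \<and> j < n \<and> i \<noteq> j \<and>
        \<not> (\<exists>L\<in>cyclic_lines n. i \<in> L \<and> j \<in> L)} \<subseteq> classes" by blast
  qed
qed

end

theorem theorem9p7:
  fixes n :: nat
    and X :: "nat \<Rightarrow> 'a set"
    and M :: "nat \<Rightarrow> nat set \<Rightarrow> ('a \<times> 'a) set"
  assumes "n \<ge> 7"
    and "cyclic_choices n X M"
  shows "\<not> separable (cyclic_points n X) (cyclic_configuration n X M) \<longleftrightarrow> 7 dvd n"
proof -
  interpret cyclic_construction n X M
    using assms by unfold_locales
  have "separable (cyclic_points n X) (cyclic_configuration n X M) \<longleftrightarrow>
      (\<forall>D. \<exists>e. \<forall>i<n. (\<Sum>l | incident n i l. e l) = (D i :: bit))"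
    using separable_iff_solvable unfolding classes_eq by (simp add: Ball_def)
  then show ?thesis
    using circulant_solvable[OF assms(1)] circulant_not_solvable[OF assms(1)] by blast
qed

end
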